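(* Let $\varepsilon\in\{+,-\}$ and let $(\theta_{\varepsilon,1},\theta_{\varepsilon,2},\phi_\varepsilon)$ be either $(\pi,2\pi/n,\pi/2)$ for a prime number $n>2$, or one of the triplets of type A4, S4 or A5 listed in the context. Let $(\theta'_{\varepsilon,1},\theta'_{\varepsilon,2})$ be either $(\theta_{\varepsilon,1}/2,\theta_{\varepsilon,2})$ or $(\theta_{\varepsilon,1},\theta_{\varepsilon,2}/2)$, suppose $0<\theta'_{\varepsilon,1}\le\pi$ and $0<\theta'_{\varepsilon,2}\le\pi$, and set $$C'_{\varepsilon,1}=C(\theta'_{\varepsilon,1}),\qquad C'_{\varepsilon,2}=U(\phi_\varepsilon)C(\theta'_{\varepsilon,2})\,{}^tU(\phi_\varepsilon).$$ Let $\nabla$ be an $h$-connection of $E$ whose holonomy matrices in $\bigwedge^2_\varepsilon E$ are $C_{\varepsilon,1}=C'_{\varepsilon,1}$ and $C_{\varepsilon,2}=C'_{\varepsilon,2}$, so that $G_{\hat\nabla,\varepsilon}$ is generated by $C'_{\varepsilon,1},C'_{\varepsilon,2}$. If $G_{\hat\nabla,\varepsilon}$ is infinite, then the two elements $C'_{\varepsilon,1}C'_{\varepsilon,2}$ and $C'_{\varepsilon,2}C'_{\varepsilon,1}$ do not commute with each other and are of infinite order.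
   Context: Matrices: $C(\theta)=\begin{pmatrix}1&0&0\\0&\cos\theta&-\sin\theta\\0&\sin\theta&\cos\theta\end{pmatrix}$, $U(\phi)=\begin{pmatrix}\cos\phi&\sin\phi&0\\-\sin\phi&\cos\phi&0\\0&0&1\end{pmatrix}$. Triplets $(\theta_1,\theta_2,\phi)$ with $\phi\in(0,\pi/2]$ (each list is understood up to interchanging $\theta_1$ and $\theta_2$): Type A4: $\theta_1=\pi$, $\theta_2\in\{2\pi/3,4\pi/3\}$, $\cos\phi=\sqrt{1/3}$; or $\theta_1,\theta_2\in\{2\pi/3,4\pi/3\}$, $\cos\phi=1/3$. Type S4: $\theta_1=\pi$, $\theta_2\in\{2\pi/3,4\pi/3\}$, $\cos\phi=\sqrt{2/3}$; or $\theta_1=\pi$, $\theta_2\in\{\pi/2,3\pi/2\}$, $\phi=\pi/4$; or $\theta_1\in\{2\pi/3,4\pi/3\}$, $\theta_2\in\{\pi/2,3\pi/2\}$, $\cos\phi=\sqrt{1/3}$; or $\theta_1,\theta_2\in\{\pi/2,3\pi/2\}$, $\phi=\pi/2$. Type A5, with $\rho=(1+\sqrt5)/2$ and $F=\{2\pi/5,4\pi/5,6\pi/5,8\pi/5\}$: $\theta_1=\pi$, $\theta_2\in\{2\pi/3,4\pi/3\}$, $\cos\phi=\rho/\sqrt3$; or $\theta_1=\pi$, $\theta_2\in F$, $\cos\phi\in\{\sqrt{\rho/\sqrt5},\sqrt{\rho^{-1}/\sqrt5}\}$; or $\theta_1,\theta_2\in\{2\pi/3,4\pi/3\}$, $\cos\phi=\sqrt5/3$;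 or $\theta_1\in\{2\pi/3,4\pi/3\}$, $\theta_2\in F$, $\cos\phi\in\{\sqrt{\rho^3/(3\sqrt5)},\sqrt{\rho^{-3}/(3\sqrt5)}\}$; or $\theta_1,\theta_2\in F$, $\cos\phi=1/\sqrt5$. Holonomy: let $T^2=S^1\times S^1$, $S^1=\mathbb{R}/2\pi\mathbb{Z}$, $\mathrm{pr}:\mathbb{R}^2\to T^2$ the projection, $E$ an oriented real vector bundle of rank 4 over $T^2$ with positive-definite metric $h$. An $h$-connection is a connection $\nabla$ with $\nabla h=0$. $\bigwedge^2E=\bigwedge^2_+E\oplus\bigwedge^2_-E$, where for a local positively oriented orthonormal frame $(e_i)$ of $E$ the bundle $\bigwedge^2_\pm E$ (rank 3) is spanned and oriented by the orthonormal frame $\frac1{\sqrt2}(e_1\wedge e_2\pm e_3\wedge e_4)$, $\frac1{\sqrt2}(e_1\wedge e_3\pm e_4\wedge e_2)$, $\frac1{\sqrt2}(e_1\wedge e_4\pm e_2\wedge e_3)$. $\nabla$ induces a metric connection $\hat\nabla$ of $\bigwedge^2E$ restricting to $\bigwedge^2_\pm E$. Fix a positively oriented orthonormal basis $(\omega_{\varepsilon,i})$ of the fiber of $\bigwedge^2_\varepsilon E$ at $\mathrm{pr}(0,0)$; the $\hat\nabla$-parallel sections $\tilde\Omega_{\varepsilon,i,x}$, $\tilde\Omega_{\varepsilon,i,y}$ of $\mathrm{pr}^*\bigwedge^2_\varepsilon E$ along the $x$- and $y$-axis with value $\omega_{\varepsilon,i}$ at $(0,0)$ satisfy (identifying fibers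 over points differing by $2\pi\mathbb{Z}^2$) $(\tilde\Omega_{\varepsilon,i,x}(a+2\pi,0))_i=(\tilde\Omega_{\varepsilon,i,x}(a,0))_iC_{\varepsilon,1}$ and $(\tilde\Omega_{\varepsilon,i,y}(0,b+2\pi))_i=(\tilde\Omega_{\varepsilon,i,y}(0,b))_iC_{\varepsilon,2}$ for all $a,b\in\mathbb{R}$, with $C_{\varepsilon,1},C_{\varepsilon,2}\in SO(3)$ (the holonomy matrices). The topological holonomy group $G_{\hat\nabla,\varepsilon}$ is the subgroup of $SO(3)$ generated by $C_{\varepsilon,1},C_{\varepsilon,2}$. *)

theory Defs
  imports
    "HOL-Analysis.Analysis"
    "HOL-Computational_Algebra.Primes"
    "HOL-Algebra.Generated_Groups"
begin

section \<open>Smooth functions and the torus\<close>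

text \<open>For an open set \<open>S\<close> of a finite-dimensional space this is the class \<open>C\<^sup>k\<close>, phrased by
  iterated directional derivatives.\<close>

fun Ck_on :: "nat \<Rightarrow> 'a::real_normed_vector set \<Rightarrow> ('a \<Rightarrow> 'b::real_normed_vector) \<Rightarrow> bool" where
  "Ck_on 0 S f \<longleftrightarrow> continuous_on S f"
| "Ck_on (Suc k) S f \<longleftrightarrow> (\<forall>x\<in>S. f differentiable (at x)) \<and>
     (\<forall>v. Ck_on k S (\<lambda>x. frechet_derivative f (at x) v))"

quotient_type circle = real / "\<lambda>x y. \<exists>k::int. y = x + 2 * pi * of_int k"
proof (rule equivpI)
  show "reflp (\<lambda>x y. \<exists>k::int. y = x + 2 * pi * of_int k)"
    by (rule reflpI) (rule exI[of _ 0], simp)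
  show "symp (\<lambda>x y. \<exists>k::int. y = x + 2 * pi * of_int k)"
  proof (rule sympI, elim exE)
    fix x y :: real and k :: int assume "y = x + 2 * pi * of_int k"
    then show "\<exists>k::int. x = y + 2 * pi * of_int k" by (intro exI[of _ "- k"]) simp
  qed
  show "transp (\<lambda>x y. \<exists>k::int. y = x + 2 * pi * of_int k)"
  proof (rule transpI, elim exE)
    fix x y z :: real and k l :: int
    assume "y = x + 2 * pi * of_int k" "z = y + 2 * pi * of_int l"
    then show "\<exists>k::int. z = x + 2 * pi * of_int k"
      by (intro exI[of _ "k + l"]) (simp add: algebra_simps)
  qed
qed

instantiation circle :: topological_space
begin

definition open_circle :: "circle set \<Rightarrow> bool" where
  "open_circle U \<longleftrightarrow> open (abs_circle -` U)"

instance
proof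
  show "open (UNIV :: circle set)" by (simp add: open_circle_def)
  show "open (S \<inter> T)" if "open S" "open T" for S T :: "circle set"
    using that by (simp add: open_circle_def open_Int)
  show "open (\<Union> K)" if "\<forall>S\<in>K. open S" for K :: "circle set set"
    using that by (auto simp: open_circle_def vimage_Union)
qed

end

type_synonym torus = "circle \<times> circle"

definition pr :: "real \<times> real \<Rightarrow> torus" where
  "pr z = (abs_circle (fst z), abs_circle (snd z))"

definition smooth_on_torus :: "torus set \<Rightarrow> (torus \<Rightarrow> 'b::real_normed_vector) \<Rightarrow> bool" where
  "smooth_on_torus U f \<longleftrightarrow> (\<forall>k. Ck_on k (pr -` U) (f \<circ> pr))"

text \<open>The derivative of \<open>f\<close> at \<open>pr z\<close> along the tangent vector \<open>v\<close>; the tangent bundle of the torus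
  is identified with the trivial bundle by means of the coordinate fields, so that vector fields
  are functions \<open>torus \<Rightarrow> real \<times> real\<close>.\<close>

definition torus_deriv :: "(torus \<Rightarrow> 'b::real_normed_vector) \<Rightarrow> real \<times> real \<Rightarrow> real \<times> real \<Rightarrow> 'b" where
  "torus_deriv f v z = frechet_derivative (f \<circ> pr) (at z) v"


section \<open>Vector bundles, metrics and connections\<close>

text \<open>The fibres of a bundle are subspaces \<open>E p\<close> of one real vector space \<open>'v\<close>, which carries no
  topology. This is no restriction: the fibres of any bundle embed in their direct sum, and the
  smooth structure is carried entirely by the atlas of local frames.\<close>

type_synonym 'v bsection = "torus \<Rightarrow> 'v"
type_synonym ('i, 'v) atlas = "(torus set \<times> ('i \<Rightarrow> 'v bsection)) set"

definition local_frame ::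
  "(torus \<Rightarrow> 'v::real_vector set) \<Rightarrow> torus set \<Rightarrow> ('i::finite \<Rightarrow> 'v bsection) \<Rightarrow> bool" where
  "local_frame E U e \<longleftrightarrow> open U \<and>
     (\<forall>p\<in>U. inj (\<lambda>i. e i p) \<and> independent (range (\<lambda>i. e i p)) \<and> span (range (\<lambda>i. e i p)) = E p)"

text \<open>An oriented vector bundle of rank \<open>CARD('i)\<close>: all frames in the atlas are positively oriented.\<close>

definition oriented_bundle :: "(torus \<Rightarrow> 'v::real_vector set) \<Rightarrow> ('i::finite, 'v) atlas \<Rightarrow> bool" where
  "oriented_bundle E A \<longleftrightarrow>
     (\<Union>(U, e)\<in>A. U) = UNIV \<and>
     (\<forall>(U, e)\<in>A. local_frame E U e) \<and>
     (\<forall>(U, e)\<in>A. \<forall>(V, f)\<in>A. \<exists>g :: torus \<Rightarrow> real^'i^'i.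
        (\<forall>i j. smooth_on_torus (U \<inter> V) (\<lambda>p. g p $ i $ j)) \<and>
        (\<forall>p\<in>U \<inter> V. det (g p) > 0 \<and> (\<forall>j. e j p = (\<Sum>i\<in>UNIV. (g p $ i $ j) *\<^sub>R f i p))))"

text \<open>Here and below \<open>A\<close> need only consist of smooth local generators, not necessarily of frames;
  the coefficients of a smooth section can then be chosen smooth.\<close>

definition smooth_section :: "('i::finite, 'v::real_vector) atlas \<Rightarrow> 'v bsection \<Rightarrow> bool" where
  "smooth_section A s \<longleftrightarrow>
     (\<forall>(U, e)\<in>A. \<exists>f. (\<forall>i. smooth_on_torus U (f i)) \<and>
        (\<forall>p\<in>U. s p = (\<Sum>i\<in>UNIV. f i p *\<^sub>R e i p)))"

definition bundle_metric ::
  "(torus \<Rightarrow> 'v::real_vector set) \<Rightarrow> ('i::finite, 'v) atlas \<Rightarrow> (torus \<Rightarrow> 'v \<Rightarrow> 'v \<Rightarrow> real) \<Rightarrow> bool" where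
  "bundle_metric E A h \<longleftrightarrow>
     (\<forall>p. \<forall>u\<in>E p. \<forall>v\<in>E p. \<forall>w\<in>E p. \<forall>c.
        h p (u + v) w = h p u w + h p v w \<and> h p (c *\<^sub>R u) w = c * h p u w \<and> h p u w = h p w u) \<and>
     (\<forall>p. \<forall>u\<in>E p. u \<noteq> 0 \<longrightarrow> h p u u > 0) \<and>
     (\<forall>(U, e)\<in>A. \<forall>i j. smooth_on_torus U (\<lambda>p. h p (e i p) (e j p)))"

type_synonym 'v conn = "(torus \<Rightarrow> real \<times> real) \<Rightarrow> 'v bsection \<Rightarrow> 'v bsection"

definition connection :: "('i::finite, 'v::real_vector) atlas \<Rightarrow> 'v conn \<Rightarrow> bool" where
  "connection A D \<longleftrightarrow>
     (\<forall>X s. smooth_on_torus UNIV X \<longrightarrow> smooth_section A s \<longrightarrow> smooth_section A (D X s)) \<and>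
     (\<forall>X Y f s. smooth_on_torus UNIV X \<longrightarrow> smooth_on_torus UNIV Y \<longrightarrow>
        smooth_on_torus UNIV f \<longrightarrow> smooth_section A s \<longrightarrow>
        D (\<lambda>p. X p + f p *\<^sub>R Y p) s = (\<lambda>p. D X s p + f p *\<^sub>R D Y s p)) \<and>
     (\<forall>X s t. smooth_on_torus UNIV X \<longrightarrow> smooth_section A s \<longrightarrow> smooth_section A t \<longrightarrow>
        D X (\<lambda>p. s p + t p) = (\<lambda>p. D X s p + D X t p)) \<and>
     (\<forall>X f s z. smooth_on_torus UNIV X \<longrightarrow> smooth_on_torus UNIV f \<longrightarrow> smooth_section A s \<longrightarrow>
        D X (\<lambda>p. f p *\<^sub>R s p) (pr z) =
          torus_deriv f (X (pr z)) z *\<^sub>R s (pr z) + f (pr z) *\<^sub>R D X s (pr z))"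

definition h_connection ::
  "('i::finite, 'v::real_vector) atlas \<Rightarrow> (torus \<Rightarrow> 'v \<Rightarrow> 'v \<Rightarrow> real) \<Rightarrow> 'v conn \<Rightarrow> bool" where
  "h_connection A h D \<longleftrightarrow> connection A D \<and>
     (\<forall>X s t z. smooth_on_torus UNIV X \<longrightarrow> smooth_section A s \<longrightarrow> smooth_section A t \<longrightarrow>
        torus_deriv (\<lambda>p. h p (s p) (t p)) (X (pr z)) z =
          h (pr z) (D X s (pr z)) (t (pr z)) + h (pr z) (s (pr z)) (D X t (pr z)))"

text \<open>\<open>w\<close> is the covariant derivative at time \<open>a\<close> of the section \<open>\<sigma>\<close> of the pulled back bundle along
  the line \<open>t \<mapsto> t v\<close> in the plane: near \<open>a\<close>, \<open>\<sigma>\<close> is a combination of global smooth sections, and the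
  pull-back connection is characterised by the Leibniz rule. The result does not depend on the
  combination chosen. The fibre over a point of the plane is by definition the fibre over its
  projection, so fibres over points differing by \<open>2\<pi>\<int>\<^sup>2\<close> are equal.\<close>

definition has_covariant_deriv ::
  "('i::finite, 'v::real_vector) atlas \<Rightarrow> 'v conn \<Rightarrow> real \<times> real \<Rightarrow> (real \<Rightarrow> 'v) \<Rightarrow> 'v \<Rightarrow> real \<Rightarrow> bool" where
  "has_covariant_deriv A D v \<sigma> w a \<longleftrightarrow>
     (\<exists>(n::nat) s f f'.
        (\<forall>k<n. smooth_section A (s k) \<and> (f k has_real_derivative f' k) (at a)) \<and>
        (\<forall>\<^sub>F t in nhds a. \<sigma> t = (\<Sum>k<n. f k t *\<^sub>R s k (pr (t *\<^sub>R v)))) \<and>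
        w = (\<Sum>k<n. f' k *\<^sub>R s k (pr (a *\<^sub>R v)) + f k a *\<^sub>R D (\<lambda>_. v) (s k) (pr (a *\<^sub>R v))))"

definition parallel_along ::
  "('i::finite, 'v::real_vector) atlas \<Rightarrow> 'v conn \<Rightarrow> real \<times> real \<Rightarrow> (real \<Rightarrow> 'v) \<Rightarrow> bool" where
  "parallel_along A D v \<sigma> \<longleftrightarrow> (\<forall>a. has_covariant_deriv A D v \<sigma> 0 a)"


section \<open>The exterior square\<close>

text \<open>The exterior square of \<open>'v\<close>, realised inside the alternating bilinear forms on the algebraic
  dual of \<open>'v\<close>: as linear functionals separate points, this realisation is faithful.\<close>

definition wedge_form ::
  "'v::real_vector \<Rightarrow> 'v \<Rightarrow> ('v \<Rightarrow> real) \<Rightarrow> ('v \<Rightarrow> real) \<Rightarrow> real" where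
  "wedge_form u v \<alpha> \<beta> = (if linear \<alpha> \<and> linear \<beta> then \<alpha> u * \<beta> v - \<alpha> v * \<beta> u else 0)"

lemma wedge_form_scaleR: "wedge_form (c *\<^sub>R u) v \<alpha> \<beta> = c * wedge_form u v \<alpha> \<beta>"
  by (auto simp: wedge_form_def linear_cmul algebra_simps)

typedef (overloaded) 'v bivector =
  "{B :: ('v::real_vector \<Rightarrow> real) \<Rightarrow> ('v \<Rightarrow> real) \<Rightarrow> real.
     \<exists>(n::nat) u v. B = (\<lambda>\<alpha> \<beta>. \<Sum>k<n. wedge_form (u k) (v k) \<alpha> \<beta>)}"
  by auto

setup_lifting type_definition_bivector

instantiation bivector :: (real_vector) real_vector
begin

lift_definition zero_bivector :: "'a bivector" is "\<lambda>\<alpha> \<beta>. 0"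
  by (rule exI[of _ 0]) simp

lift_definition plus_bivector :: "'a bivector \<Rightarrow> 'a bivector \<Rightarrow> 'a bivector"
  is "\<lambda>B C \<alpha> \<beta>. B \<alpha> \<beta> + C \<alpha> \<beta>"
proof -
  fix B C :: "('a \<Rightarrow> real) \<Rightarrow> ('a \<Rightarrow> real) \<Rightarrow> real"
  assume "\<exists>(n::nat) u v. B = (\<lambda>\<alpha> \<beta>. \<Sum>k<n. wedge_form (u k) (v k) \<alpha> \<beta>)"
    and "\<exists>(n::nat) u v. C = (\<lambda>\<alpha> \<beta>. \<Sum>k<n. wedge_form (u k) (v k) \<alpha> \<beta>)"
  then obtain m n :: nat and u v u' v' where
    B: "B = (\<lambda>\<alpha> \<beta>. \<Sum>k<n. wedge_form (u k) (v k) \<alpha> \<beta>)" and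
    C: "C = (\<lambda>\<alpha> \<beta>. \<Sum>k<m. wedge_form (u' k) (v' k) \<alpha> \<beta>)" by blast
  let ?u = "\<lambda>k. if k < n then u k else u' (k - n)"
  let ?v = "\<lambda>k. if k < n then v k else v' (k - n)"
  have "B \<alpha> \<beta> + C \<alpha> \<beta> = (\<Sum>k<n + m. wedge_form (?u k) (?v k) \<alpha> \<beta>)" for \<alpha> \<beta>
  proof -
    have "(\<Sum>k<n + m. wedge_form (?u k) (?v k) \<alpha> \<beta>) =
        (\<Sum>k<n. wedge_form (?u k) (?v k) \<alpha> \<beta>) + (\<Sum>k<m. wedge_form (?u (n + k)) (?v (n + k)) \<alpha> \<beta>)"
      by (induction m) simp_all
    then show ?thesis by (simp add: B C)
  qed
  then show "\<exists>(n::nat) u v. (\<lambda>\<alpha> \<beta>. B \<alpha> \<beta> + C \<alpha> \<beta>) = (\<lambda>\<alpha> \<beta>. \<Sum>k<n. wedge_form (u k) (v k) \<alpha> \<beta>)"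
    by (intro exI[of _ "n + m"] exI[of _ ?u] exI[of _ ?v] ext)
qed

lift_definition scaleR_bivector :: "real \<Rightarrow> 'a bivector \<Rightarrow> 'a bivector"
  is "\<lambda>c B \<alpha> \<beta>. c * B \<alpha> \<beta>"
proof -
  fix c and B :: "('a \<Rightarrow> real) \<Rightarrow> ('a \<Rightarrow> real) \<Rightarrow> real"
  assume "\<exists>(n::nat) u v. B = (\<lambda>\<alpha> \<beta>. \<Sum>k<n. wedge_form (u k) (v k) \<alpha> \<beta>)"
  then obtain n :: nat and u v where
    B: "B = (\<lambda>\<alpha> \<beta>. \<Sum>k<n. wedge_form (u k) (v k) \<alpha> \<beta>)" by blast
  show "\<exists>(n::nat) u v. (\<lambda>\<alpha> \<beta>. c * B \<alpha> \<beta>) = (\<lambda>\<alpha> \<beta>. \<Sum>k<n. wedge_form (u k) (v k) \<alpha> \<beta>)"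
    by (intro exI[of _ n] exI[of _ "\<lambda>k. c *\<^sub>R u k"] exI[of _ v])
      (simp add: B wedge_form_scaleR sum_distrib_left)
qed

definition uminus_bivector :: "'a bivector \<Rightarrow> 'a bivector" where
  "uminus_bivector B = (-1) *\<^sub>R B"

definition minus_bivector :: "'a bivector \<Rightarrow> 'a bivector \<Rightarrow> 'a bivector" where
  "minus_bivector B C = B + (- C)"

instance
proof
  fix a b c :: "'a bivector" and x y :: real
  show "a + b + c = a + (b + c)" "a + b = b + a" "0 + a = a"
    "x *\<^sub>R (a + b) = x *\<^sub>R a + x *\<^sub>R b" "(x + y) *\<^sub>R a = x *\<^sub>R a + y *\<^sub>R a"
    "x *\<^sub>R y *\<^sub>R a = (x * y) *\<^sub>R a" "1 *\<^sub>R a = a"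
    by (transfer; simp add: algebra_simps fun_eq_iff)+
  show "- a + a = 0"
    unfolding uminus_bivector_def by transfer simp
  show "a - b = a + - b"
    by (rule minus_bivector_def)
qed

end

lift_definition wedge :: "'v::real_vector \<Rightarrow> 'v \<Rightarrow> 'v bivector" (infixl \<open>\<and>\<^sub>v\<close> 71) is wedge_form
proof -
  fix u v :: 'v
  show "\<exists>(n::nat) u' v'. wedge_form u v = (\<lambda>\<alpha> \<beta>. \<Sum>k<n. wedge_form (u' k) (v' k) \<alpha> \<beta>)"
    by (intro exI[of _ 1] exI[of _ "\<lambda>_. u"] exI[of _ "\<lambda>_. v"]) simp
qed

text \<open>Smooth local generators of the exterior square of the bundle: all \<open>e\<^sub>i \<and> e\<^sub>j\<close> (with redundancy).\<close>

definition wedge_atlas :: "('i, 'v::real_vector) atlas \<Rightarrow> ('i \<times> 'i, 'v bivector) atlas" where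
  "wedge_atlas A = (\<lambda>(U, e). (U, \<lambda>(i, j) p. e i p \<and>\<^sub>v e j p)) ` A"

definition induced_connection ::
  "('i::finite, 'v::real_vector) atlas \<Rightarrow> 'v conn \<Rightarrow> 'v bivector conn \<Rightarrow> bool" where
  "induced_connection A D D2 \<longleftrightarrow> connection (wedge_atlas A) D2 \<and>
     (\<forall>X s t. smooth_on_torus UNIV X \<longrightarrow> smooth_section A s \<longrightarrow> smooth_section A t \<longrightarrow>
        D2 X (\<lambda>p. s p \<and>\<^sub>v t p) = (\<lambda>p. D X s p \<and>\<^sub>v t p + s p \<and>\<^sub>v D X t p))"

definition pos_orthonormal_basis ::
  "('i::finite, 'v::real_vector) atlas \<Rightarrow> (torus \<Rightarrow> 'v \<Rightarrow> 'v \<Rightarrow> real) \<Rightarrow> torus \<Rightarrow> ('i \<Rightarrow> 'v) \<Rightarrow> bool" where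
  "pos_orthonormal_basis A h p b \<longleftrightarrow>
     (\<forall>i j. h p (b i) (b j) = (if i = j then 1 else 0)) \<and>
     (\<exists>(U, e)\<in>A. p \<in> U \<and>
        (\<exists>g :: real^'i^'i. det g > 0 \<and> (\<forall>j. b j = (\<Sum>i\<in>UNIV. (g $ i $ j) *\<^sub>R e i p))))"

text \<open>The self-dual (\<open>\<epsilon> = 1\<close>) and anti-self-dual (\<open>\<epsilon> = -1\<close>) bivectors of an oriented orthonormal basis.
  The type \<open>4\<close> has the elements 1, 2, 3, 4 and the type \<open>3\<close> the elements 1, 2, 3.\<close>

definition dual_frame :: "real \<Rightarrow> (4 \<Rightarrow> 'v::real_vector) \<Rightarrow> 3 \<Rightarrow> 'v bivector" where
  "dual_frame \<epsilon> b i = (1 / sqrt 2) *\<^sub>R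
     (if i = 1 then b 1 \<and>\<^sub>v b 2 + \<epsilon> *\<^sub>R (b 3 \<and>\<^sub>v b 4)
      else if i = 2 then b 1 \<and>\<^sub>v b 3 + \<epsilon> *\<^sub>R (b 4 \<and>\<^sub>v b 2)
      else b 1 \<and>\<^sub>v b 4 + \<epsilon> *\<^sub>R (b 2 \<and>\<^sub>v b 3))"

definition dual_fibre ::
  "real \<Rightarrow> (4, 'v::real_vector) atlas \<Rightarrow> (torus \<Rightarrow> 'v \<Rightarrow> 'v \<Rightarrow> real) \<Rightarrow> torus \<Rightarrow> 'v bivector set" where
  "dual_fibre \<epsilon> A h p = (\<Union>b\<in>{b. pos_orthonormal_basis A h p b}. span (range (dual_frame \<epsilon> b)))"

text \<open>The metric and orientation of the fibre are those for which \<open>dual_frame \<epsilon> b\<close> is orthonormal and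
  positively oriented.\<close>

definition pos_orthonormal_dual_basis ::
  "real \<Rightarrow> (4, 'v::real_vector) atlas \<Rightarrow> (torus \<Rightarrow> 'v \<Rightarrow> 'v \<Rightarrow> real) \<Rightarrow> torus \<Rightarrow> (3 \<Rightarrow> 'v bivector) \<Rightarrow> bool"
  where
  "pos_orthonormal_dual_basis \<epsilon> A h p \<omega> \<longleftrightarrow>
     (\<exists>b R. pos_orthonormal_basis A h p b \<and> orthogonal_matrix R \<and> det R = 1 \<and>
        (\<forall>j. \<omega> j = (\<Sum>i\<in>UNIV. (R $ i $ j) *\<^sub>R dual_frame \<epsilon> b i)))"


section \<open>Holonomy\<close>

text \<open>\<open>C\<close> is the holonomy matrix along the axis spanned by \<open>v\<close> (\<open>v = (1, 0)\<close> or \<open>v = (0, 1)\<close>).\<close>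

definition holonomy_matrix ::
  "real \<Rightarrow> (4, 'v::real_vector) atlas \<Rightarrow> (torus \<Rightarrow> 'v \<Rightarrow> 'v \<Rightarrow> real) \<Rightarrow> 'v bivector conn \<Rightarrow>
    (3 \<Rightarrow> 'v bivector) \<Rightarrow> real \<times> real \<Rightarrow> real^3^3 \<Rightarrow> bool" where
  "holonomy_matrix \<epsilon> A h D2 \<omega> v C \<longleftrightarrow>
     (\<exists>\<Omega> :: 3 \<Rightarrow> real \<Rightarrow> 'v bivector.
        (\<forall>i. parallel_along (wedge_atlas A) D2 v (\<Omega> i) \<and> \<Omega> i 0 = \<omega> i) \<and>
        (\<forall>i t. \<Omega> i t \<in> dual_fibre \<epsilon> A h (pr (t *\<^sub>R v))) \<and>
        (\<forall>j t. \<Omega> j (t + 2 * pi) = (\<Sum>i\<in>UNIV. (C $ i $ j) *\<^sub>R \<Omega> i t)))"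

definition SO3 :: "(real^3^3) monoid" where
  "SO3 = \<lparr>carrier = {M. orthogonal_matrix M \<and> det M = 1}, mult = (**), one = mat 1\<rparr>"

definition infinite_order :: "('a, 'b) monoid_scheme \<Rightarrow> 'a \<Rightarrow> bool" where
  "infinite_order G x \<longleftrightarrow> (\<forall>n::nat. n > 0 \<longrightarrow> x [^]\<^bsub>G\<^esub> n \<noteq> \<one>\<^bsub>G\<^esub>)"


section \<open>The rotations and the list of triplets\<close>

definition Cmat :: "real \<Rightarrow> real^3^3" where
  "Cmat \<theta> = vector [vector [1, 0, 0],
                    vector [0, cos \<theta>, - sin \<theta>],
                    vector [0, sin \<theta>, cos \<theta>]]"

definition Umat :: "real \<Rightarrow> real^3^3" where
  "Umat \<phi> = vector [vector [cos \<phi>, sin \<phi>, 0],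
                    vector [- sin \<phi>, cos \<phi>, 0],
                    vector [0, 0, 1]]"

definition swap_closure :: "(real \<times> real \<times> real) set \<Rightarrow> (real \<times> real \<times> real) set" where
  "swap_closure S = S \<union> {(\<theta>2, \<theta>1, \<phi>) | \<theta>1 \<theta>2 \<phi>. (\<theta>1, \<theta>2, \<phi>) \<in> S}"

definition thirds :: "real set" where "thirds = {2 * pi / 3, 4 * pi / 3}"
definition quarters :: "real set" where "quarters = {pi / 2, 3 * pi / 2}"
definition fifths :: "real set" where
  "fifths = {2 * pi / 5, 4 * pi / 5, 6 * pi / 5, 8 * pi / 5}"

definition golden :: real where "golden = (1 + sqrt 5) / 2"

definition type_A4 :: "(real \<times> real \<times> real) set" where
  "type_A4 = swap_closure {(\<theta>1, \<theta>2, \<phi>). 0 < \<phi> \<and> \<phi> \<le> pi / 2 \<and>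
     (\<theta>1 = pi \<and> \<theta>2 \<in> thirds \<and> cos \<phi> = sqrt (1 / 3) \<or>
      \<theta>1 \<in> thirds \<and> \<theta>2 \<in> thirds \<and> cos \<phi> = 1 / 3)}"

definition type_S4 :: "(real \<times> real \<times> real) set" where
  "type_S4 = swap_closure {(\<theta>1, \<theta>2, \<phi>). 0 < \<phi> \<and> \<phi> \<le> pi / 2 \<and>
     (\<theta>1 = pi \<and> \<theta>2 \<in> thirds \<and> cos \<phi> = sqrt (2 / 3) \<or>
      \<theta>1 = pi \<and> \<theta>2 \<in> quarters \<and> \<phi> = pi / 4 \<or>
      \<theta>1 \<in> thirds \<and> \<theta>2 \<in> quarters \<and> cos \<phi> = sqrt (1 / 3) \<or>
      \<theta>1 \<in> quarters \<and> \<theta>2 \<in> quarters \<and> \<phi> = pi / 2)}"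

definition type_A5 :: "(real \<times> real \<times> real) set" where
  "type_A5 = swap_closure {(\<theta>1, \<theta>2, \<phi>). 0 < \<phi> \<and> \<phi> \<le> pi / 2 \<and>
     (\<theta>1 = pi \<and> \<theta>2 \<in> thirds \<and> cos \<phi> = golden / sqrt 3 \<or>
      \<theta>1 = pi \<and> \<theta>2 \<in> fifths \<and>
        cos \<phi> \<in> {sqrt (golden / sqrt 5), sqrt (inverse golden / sqrt 5)} \<or>
      \<theta>1 \<in> thirds \<and> \<theta>2 \<in> thirds \<and> cos \<phi> = sqrt 5 / 3 \<or>
      \<theta>1 \<in> thirds \<and> \<theta>2 \<in> fifths \<and>
        cos \<phi> \<in> {sqrt (golden ^ 3 / (3 * sqrt 5)), sqrt (inverse golden ^ 3 / (3 * sqrt 5))} \<or>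
      \<theta>1 \<in> fifths \<and> \<theta>2 \<in> fifths \<and> cos \<phi> = 1 / sqrt 5)}"

end

theory Submission
  imports Defs "Jordan_Normal_Form.Char_Poly"
begin

text \<open>
  Lift the two rotations to unit quaternions \<open>p\<close> and \<open>q\<close>, with half angles
  \<open>\<alpha> = \<theta>1' / 2\<close> and \<open>\<beta> = \<theta>2' / 2\<close> and axes at angle \<open>\<phi>\<close>, and put \<open>x = 2 cos \<alpha>\<close>,
  \<open>y = 2 cos \<beta>\<close> and \<open>z = 2 Re (p q)\<close>. If the rotation of \<open>p q\<close> had finite order, then \<open>z\<close> would be a
  sum of two roots of unity; \<open>x\<close> and \<open>y\<close> are such sums anyway, because \<open>\<alpha>\<close> and \<open>\<beta>\<close> are
  rational multiples of \<open>\<pi>\<close>. Hence the Gram determinant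
  \<open>D = 4 - (x\<^sup>2 + y\<^sup>2 + z\<^sup>2 - x y z) = (1 - cos \<theta>1') (1 - cos \<theta>2') (1 - cos\<^sup>2 \<phi>)\<close>
  would be an algebraic integer (\<open>gram_integral_of_finite_order\<close>). The gain over looking at \<open>z\<close> itself is
  that \<open>D\<close> contains no product of sines, so that in each case it lies in \<open>\<rat>(\<surd>5)\<close>, in \<open>\<rat>(\<surd>2)\<close>
  or, in the dihedral case, in a cyclotomic field.

  It remains to see that the group is finite whenever \<open>D\<close> is integral. Apart from the dihedral pair
  \<open>(\<pi>, \<pi>/n)\<close>, which generates a dihedral group, the angles run through a finite list. There either
  \<open>D\<close> is visibly not integral (\<open>nonintegral_table\<close>, and \<open>not_algebraic_int_cos_odd\<close> for the other
  dihedral pair \<open>(\<pi>/2, 2\<pi>/n)\<close>), or \<open>x\<close>, \<open>y\<close>, \<open>z\<close> lie in \<open>\<int>[\<surd>2]\<close> or in \<open>\<int>[\<rho>]\<close>, where \<open>\<rho>\<close> is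
  the golden ratio, and the Gram determinant of their Galois conjugates is positive. In the second case \<open>1, p, q, p q\<close>
  span an order in a quaternion algebra that is definite at both real places. Its unit group is finite
  because it is discrete in a product of two compact groups
  (\<open>finite_generate_of_spherical_conjugate\<close>), and so is the group generated by the two rotations.

  The element \<open>q p\<close> is conjugate to \<open>p q\<close>, so it has infinite order as well. The axes of \<open>p q\<close> and
  \<open>q p\<close> are mirror images in the plane of the axes of \<open>p\<close> and \<open>q\<close>. They are different unless both rotations
  are half turns, which cannot be because one of the two angles is half of an angle below \<open>2\<pi>\<close>;
  and rotations of infinite order commute only if they have the same axis
  (\<open>infinite_order_products_do_not_commute\<close>).
\<close>

section \<open>Algebraic integers\<close>

lemma algebraic_int_eigenvalue_int_matrix:
  fixes x :: complex and v :: "nat \<Rightarrow> complex" and m :: "nat \<Rightarrow> nat \<Rightarrow> int"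
  assumes eq: "\<And>i. i < n \<Longrightarrow> x * v i = (\<Sum>j<n. of_int (m i j) * v j)"
    and nz: "k < n" "v k \<noteq> 0"
  shows "algebraic_int x"
proof -
  define M where "M = Matrix.mat n n (\<lambda>(i, j). m i j)"
  have M: "M \<in> carrier_mat n n" by (simp add: M_def)
  let ?C = "map_mat of_int M :: complex mat"
  have C: "?C \<in> carrier_mat n n" using M by simp
  have "eigenvector ?C (Matrix.vec n v) x"
    unfolding eigenvector_def
  proof (intro conjI)
    show "Matrix.vec n v \<in> carrier_vec (dim_row ?C)" using M by simp
    show "Matrix.vec n v \<noteq> 0\<^sub>v (dim_row ?C)"
      using M nz by (auto simp: vec_eq_iff)
    show "?C *\<^sub>v Matrix.vec n v = x \<cdot>\<^sub>v Matrix.vec n v"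
      using eq by (intro eq_vecI) (auto simp: M_def scalar_prod_def atLeast0LessThan)
  qed
  then have "poly (char_poly ?C) x = 0"
    using eigenvalue_root_char_poly[OF C] eigenvalue_def by blast
  then have root: "poly (map_poly of_int (char_poly M)) x = 0"
    by (simp add: of_int_hom.char_poly_hom[OF M])
  moreover have "lead_coeff (char_poly M) = 1"
    using degree_monic_char_poly[OF M] by simp
  ultimately show ?thesis unfolding algebraic_int_altdef_ipoly by blast
qed

text \<open>The ring-theoretic characterisation of integrality: multiplication by \<open>x\<close> maps the group generated
  by the \<open>v i\<close> into itself, so \<open>x\<close> is an eigenvalue of an integer matrix and a root of its
  characteristic polynomial. Sums and products are integral because both act on the group generated by the monomials
  \<open>x\<^sup>i y\<^sup>j\<close> of bounded degree.\<close>

lemma algebraic_int_finitely_generated: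
  fixes x :: complex and v :: "'i \<Rightarrow> complex"
  assumes "finite I"
    and eq: "\<And>i. i \<in> I \<Longrightarrow> \<exists>c. x * v i = (\<Sum>j\<in>I. of_int (c j) * v j)"
    and nz: "k \<in> I" "v k \<noteq> 0"
  shows "algebraic_int x"
proof -
  obtain f n where f: "bij_betw f {..<n::nat} I"
    using ex_bij_betw_nat_finite[OF \<open>finite I\<close>] by (auto simp: atLeast0LessThan)
  obtain c where c: "\<And>i. i \<in> I \<Longrightarrow> x * v i = (\<Sum>j\<in>I. of_int (c i j) * v j)"
    using eq by metis
  obtain k' where k': "k' < n" "f k' = k"
    using f nz(1) by (metis bij_betw_iff_bijections lessThan_iff)
  show ?thesis
  proof (rule algebraic_int_eigenvalue_int_matrix)
    fix i assume "i < n"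
    then have "f i \<in> I" using f by (auto simp: bij_betw_def)
    then show "x * (v \<circ> f) i = (\<Sum>j<n. of_int (c (f i) (f j)) * (v \<circ> f) j)"
      using c sum.reindex_bij_betw[OF f, of "\<lambda>j. of_int (c (f i) j) * v j"] by simp
  next
    show "k' < n" "(v \<circ> f) k' \<noteq> 0" using k' nz by simp_all
  qed
qed


lemma algebraic_int_power_reduce:
  fixes x :: complex
  assumes "algebraic_int x"
  obtains k c where "k > 0" "\<And>m. x ^ m = (\<Sum>i<k. of_int (c m i) * x ^ i)"
proof -
  obtain p :: "int poly" where p: "poly (map_poly of_int p) x = 0" "lead_coeff p = 1"
    using assms by (auto simp: algebraic_int_altdef_ipoly)
  define k where "k = degree p"
  have "k \<noteq> 0"
  proof
    assume "k = 0"
    then obtain a where "p = [:a:]" unfolding k_def by (rule degree_eq_zeroE)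
    then have "p = 1" using p(2) by (simp add: pCons_one)
    then show False using p(1) by simp
  qed
  have xk: "x ^ k = (\<Sum>i<k. of_int (- coeff p i) * x ^ i)"
  proof -
    have "0 = (\<Sum>i\<le>k. of_int (coeff p i) * x ^ i)"
      using p(1) by (simp add: poly_altdef k_def)
    also have "{..k} = insert k {..<k}" by auto
    also have "(\<Sum>i\<in>\<dots>. of_int (coeff p i) * x ^ i) = x ^ k + (\<Sum>i<k. of_int (coeff p i) * x ^ i)"
      using p(2) by (simp add: k_def)
    finally show ?thesis by (simp add: sum_negf eq_neg_iff_add_eq_0)
  qed
  have "\<exists>c. x ^ m = (\<Sum>i<k. of_int (c i) * x ^ i)" for m
  proof (induction m)
    case 0
    obtain l where "k = Suc l" using \<open>k \<noteq> 0\<close> not0_implies_Suc by blast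
    then have "x ^ 0 = (\<Sum>i<k. of_int (if i = 0 then 1 else 0) * x ^ i)"
      by (simp add: sum.lessThan_Suc_shift del: sum.lessThan_Suc)
    then show ?case by (rule exI[of _ "\<lambda>i. if i = 0 then 1 else 0"])
  next
    case (Suc m)
    then obtain c where c: "x ^ m = (\<Sum>i<k. of_int (c i) * x ^ i)" by blast
    obtain l where l: "k = Suc l" using \<open>k \<noteq> 0\<close> not0_implies_Suc by blast
    let ?d = "\<lambda>i. (if i = 0 then 0 else c (i - 1)) - c l * coeff p i"
    have "x ^ Suc m = (\<Sum>i<k. of_int (c i) * x ^ Suc i)"
      by (simp add: c sum_distrib_left algebra_simps)
    also have "\<dots> = (\<Sum>i<l. of_int (c i) * x ^ Suc i) + of_int (c l) * x ^ k"
      by (simp add: l)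
    also have "(\<Sum>i<l. of_int (c i) * x ^ Suc i) = (\<Sum>i<k. of_int (if i = 0 then 0 else c (i - 1)) * x ^ i)"
      unfolding l sum.lessThan_Suc_shift by simp
    also have "of_int (c l) * x ^ k = (\<Sum>i<k. of_int (- c l * coeff p i) * x ^ i)"
      unfolding xk sum_distrib_left by (rule sum.cong) simp_all
    also have "(\<Sum>i<k. of_int (if i = 0 then 0 else c (i - 1)) * x ^ i) + \<dots> = (\<Sum>i<k. of_int (?d i) * x ^ i)"
      unfolding sum.distrib[symmetric] by (rule sum.cong) (auto simp: algebra_simps)
    finally show ?case by (intro exI[of _ ?d])
  qed
  then obtain c where "\<And>m. x ^ m = (\<Sum>i<k. of_int (c m i) * x ^ i)" by metis
  then show ?thesis using that \<open>k \<noteq> 0\<close> by blast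
qed


lemma algebraic_int_add_mult_complex:
  fixes x y :: complex
  assumes "algebraic_int x" "algebraic_int y"
  shows "algebraic_int (x + y)" "algebraic_int (x * y)"
proof -
  obtain k c where k: "k > 0" and c: "\<And>m. x ^ m = (\<Sum>i<k. of_int (c m i) * x ^ i)"
    using algebraic_int_power_reduce[OF assms(1)] by blast
  obtain l d where l: "l > 0" and d: "\<And>m. y ^ m = (\<Sum>i<l. of_int (d m i) * y ^ i)"
    using algebraic_int_power_reduce[OF assms(2)] by blast
  let ?I = "{..<k} \<times> {..<l}"
  define v where "v ij = x ^ fst ij * y ^ snd ij" for ij :: "nat \<times> nat"
  have mon: "x ^ a * y ^ b = (\<Sum>ij\<in>?I. of_int (c a (fst ij) * d b (snd ij)) * v ij)" for a b
  proof -
    have "x ^ a * y ^ b = (\<Sum>i<k. of_int (c a i) * x ^ i) * (\<Sum>j<l. of_int (d b j) * y ^ j)"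
      by (simp only: c[symmetric] d[symmetric])
    also have "\<dots> = (\<Sum>ij\<in>?I. of_int (c a (fst ij) * d b (snd ij)) * v ij)"
      unfolding sum_product sum.cartesian_product
      by (rule sum.cong) (auto simp: v_def mult_ac)
    finally show ?thesis .
  qed
  have "\<exists>e. (x * y) * v ij = (\<Sum>j\<in>?I. of_int (e j) * v j)" for ij
  proof
    have "(x * y) * v ij = x ^ Suc (fst ij) * y ^ Suc (snd ij)"
      by (simp add: v_def)
    also note mon
    finally show "(x * y) * v ij = (\<Sum>j\<in>?I.
      of_int (c (Suc (fst ij)) (fst j) * d (Suc (snd ij)) (snd j)) * v j)" .
  qed
  then show "algebraic_int (x * y)"
    by (intro algebraic_int_finitely_generated[of ?I "x * y" v "(0, 0)"])
      (use k l in \<open>auto simp: v_def\<close>)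
  have "\<exists>e. (x + y) * v ij = (\<Sum>j\<in>?I. of_int (e j) * v j)" for ij
  proof
    have "(x + y) * v ij = x ^ Suc (fst ij) * y ^ snd ij + x ^ fst ij * y ^ Suc (snd ij)"
      by (simp add: v_def algebra_simps)
    also have "\<dots> = (\<Sum>j\<in>?I. of_int (c (Suc (fst ij)) (fst j) * d (snd ij) (snd j)
        + c (fst ij) (fst j) * d (Suc (snd ij)) (snd j)) * v j)"
      unfolding mon sum.distrib[symmetric] of_int_add distrib_right ..
    finally show "(x + y) * v ij = (\<Sum>j\<in>?I. of_int (c (Suc (fst ij)) (fst j) * d (snd ij) (snd j)
        + c (fst ij) (fst j) * d (Suc (snd ij)) (snd j)) * v j)" .
  qed
  then show "algebraic_int (x + y)"
    by (intro algebraic_int_finitely_generated[of ?I "x + y" v "(0, 0)"])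
      (use k l in \<open>auto simp: v_def\<close>)
qed
lemma algebraic_int_add_real:
  fixes x y :: real
  assumes "algebraic_int x" "algebraic_int y"
  shows "algebraic_int (x + y)"
  using algebraic_int_add_mult_complex(1)[of "of_real x" "of_real y"] assms
  by (simp flip: of_real_add)

lemma algebraic_int_mult_real:
  fixes x y :: real
  assumes "algebraic_int x" "algebraic_int y"
  shows "algebraic_int (x * y)"
  using algebraic_int_add_mult_complex(2)[of "of_real x" "of_real y"] assms
  by (simp flip: of_real_mult)

lemma algebraic_int_diff_real:
  fixes x y :: real
  assumes "algebraic_int x" "algebraic_int y"
  shows "algebraic_int (x - y)"
  using algebraic_int_add_real[of x "- y"] assms by simp

lemma algebraic_int_sum_real:
  fixes f :: "'i \<Rightarrow> real"
  assumes "\<And>i. i \<in> I \<Longrightarrow> algebraic_int (f i)"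
  shows "algebraic_int (\<Sum>i\<in>I. f i)"
  using assms by (induction I rule: infinite_finite_induct) (simp_all add: algebraic_int_add_real)

lemma algebraic_int_power_real:
  fixes x :: real
  assumes "algebraic_int x"
  shows "algebraic_int (x ^ n)"
  by (induction n) (auto intro: algebraic_int_mult_real assms)

lemma algebraic_int_root_of_unity:
  fixes z :: complex
  assumes "z ^ n = 1" "n > 0"
  shows "algebraic_int z"
  by (rule algebraic_int_root[of 1 "monom 1 n"])
    (use assms in \<open>simp_all add: poly_monom degree_monom_eq\<close>)

text \<open>Here \<open>cis x\<close> is a root of unity of order dividing \<open>2 n\<close>, and \<open>2 cos x = cis x +
  cis (- x)\<close>.\<close>

lemma algebraic_int_2cos:
  assumes "cos (real n * x) = 1 \<or> cos (real n * x) = -1" "n > 0"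
  shows "algebraic_int (2 * cos x)"
proof -
  have "sin (real n * x) = 0" using sin_cos_squared_add[of "real n * x"] assms(1)
    by (metis add_cancel_left_left power2_eq_1_iff zero_eq_power2)
  then have "(cis x ^ n) = 1 \<or> (cis x ^ n) = -1"
    using assms(1) by (auto simp: Complex.DeMoivre complex_eq_iff)
  then have z: "cis x ^ (2 * n) = 1" by (auto simp: mult.commute[of 2] power_mult)
  then have "algebraic_int (cis x)"
    using assms(2) by (intro algebraic_int_root_of_unity[of _ "2 * n"]) auto
  then have "algebraic_int (cis x + cnj (cis x))"
    by (intro algebraic_int_add_mult_complex algebraic_int_cnj)
  also have "cis x + cnj (cis x) = of_real (2 * cos x)"
    by (simp add: complex_eq_iff)
  finally show ?thesis by (simp only: algebraic_int_of_real_iff)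
qed

text \<open>\<open>cos (j x)\<close> is a Chebyshev polynomial in \<open>cos x\<close> with integer coefficients.\<close>

lemma algebraic_int_cos_multiple:
  assumes "algebraic_int (cos x)"
  shows "algebraic_int (cos (real j * x))"
proof (induction j rule: induct_nat_012)
  case (ge2 j)
  have "cos (real (Suc (Suc j)) * x) = cos (real (Suc j) * x + x)"
    "cos (real j * x) = cos (real (Suc j) * x - x)"
    by (simp_all add: algebra_simps)
  then have "cos (real (Suc (Suc j)) * x) = 2 * (cos x * cos (real (Suc j) * x)) - cos (real j * x)"
    by (simp add: cos_add cos_diff)
  with ge2 assms show ?case
    by (simp add: algebraic_int_mult_real algebraic_int_diff_real)
qed (use assms in auto)

text \<open>The Dirichlet kernel; the left-hand side telescopes.\<close>

lemma sum_cos_multiples: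
  "2 * sin (x / 2) * (\<Sum>j=1..k. cos (real j * x)) = sin (real (2 * k + 1) * (x / 2)) - sin (x / 2)"
proof (induction k)
  case (Suc k)
  have "sin (real (2 * Suc k + 1) * (x / 2)) = sin (real (Suc k) * x + x / 2)"
    "sin (real (2 * k + 1) * (x / 2)) = sin (real (Suc k) * x - x / 2)"
    by (simp_all add: field_simps)
  then have "sin (real (2 * Suc k + 1) * (x / 2)) - sin (real (2 * k + 1) * (x / 2))
      = 2 * sin (x / 2) * cos (real (Suc k) * x)"
    by (simp only: sin_add sin_diff) simp
  with Suc show ?case by (simp add: algebra_simps)
qed simp

text \<open>If \<open>cos (2\<pi>/n)\<close> were integral, so would be all \<open>cos (2\<pi>j/n)\<close>. But the sum of
  the \<open>n\<close>-th roots of unity vanishes, and folding it in pairs shows that half of these cosines add up to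
  \<open>-1/2\<close>.\<close>

lemma not_algebraic_int_cos_odd:
  assumes "odd n" "n > 1"
  shows "\<not> algebraic_int (cos (2 * pi / real n))"
proof
  let ?x = "2 * pi / real n"
  assume "algebraic_int (cos ?x)"
  then have int: "algebraic_int (cos (real j * ?x))" for j
    by (rule algebraic_int_cos_multiple)
  obtain k where k: "n = 2 * k + 1" using assms(1) by (rule oddE)
  have "0 < pi / real n" "pi / real n < pi" using assms(2) by (simp_all add: field_simps)
  then have "sin (?x / 2) \<noteq> 0" using sin_gt_zero[of "?x / 2"] by simp
  have "real n * (?x / 2) = pi" using assms(2) by simp
  then have "sin (?x / 2) * (2 * (\<Sum>j=1..k. cos (real j * ?x))) = sin (?x / 2) * (- 1)"
    using sum_cos_multiples[of ?x k] unfolding k[symmetric] by (simp only: mult_ac) simp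
  with \<open>sin (?x / 2) \<noteq> 0\<close> have "2 * (\<Sum>j=1..k. cos (real j * ?x)) = - 1"
    unfolding mult_left_cancel[OF \<open>sin (?x / 2) \<noteq> 0\<close>] by blast
  then have "(\<Sum>j=1..k. cos (real j * ?x)) = - (1 / 2)" by linarith
  moreover have "algebraic_int (\<Sum>j=1..k. cos (real j * ?x))"
    by (intro algebraic_int_sum_real int)
  ultimately have "(1 / 2 :: real) \<in> \<int>"
    using rational_algebraic_int_is_int[of "1 / 2 :: real"] by auto
  then show False by (auto elim!: Ints_cases simp: field_simps simp flip: of_int_mult)
qed

hide_const (open) Matrix.mat Matrix.vec
no_notation vec_index (infixl \<open>$\<close> 100)


section \<open>Quaternions and rotations\<close>

text \<open>Real quaternions: every rotation lifts to a unit quaternion, on which half the rotation angle and the axis can be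
  read off. This turns questions about the order of a rotation into questions about real parts.\<close>

datatype quat = Quat (qre: real) (qi: real) (qj: real) (qk: real)

lemma quat_eqI: "qre x = qre y \<Longrightarrow> qi x = qi y \<Longrightarrow> qj x = qj y \<Longrightarrow> qk x = qk y \<Longrightarrow> x = y"
  by (simp add: quat.expand)

lemma quat_eq_iff: "x = y \<longleftrightarrow> qre x = qre y \<and> qi x = qi y \<and> qj x = qj y \<and> qk x = qk y"
  by (auto intro: quat_eqI)

instantiation quat :: real_algebra_1
begin

definition "0 = Quat 0 0 0 0"
definition "1 = Quat 1 0 0 0"
definition "x + y = Quat (qre x + qre y) (qi x + qi y) (qj x + qj y) (qk x + qk y)"
definition "- x = Quat (- qre x) (- qi x) (- qj x) (- qk x)" for x :: quat
definition "x - y = Quat (qre x - qre y) (qi x - qi y) (qj x - qj y) (qk x - qk y)"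
definition "r *\<^sub>R x = Quat (r * qre x) (r * qi x) (r * qj x) (r * qk x)"
definition "x * y = Quat
  (qre x * qre y - qi x * qi y - qj x * qj y - qk x * qk y)
  (qre x * qi y + qi x * qre y + qj x * qk y - qk x * qj y)
  (qre x * qj y - qi x * qk y + qj x * qre y + qk x * qi y)
  (qre x * qk y + qi x * qj y - qj x * qi y + qk x * qre y)"

lemmas quat_defs = zero_quat_def one_quat_def plus_quat_def uminus_quat_def minus_quat_def
  scaleR_quat_def times_quat_def

instance
  by standard (simp_all add: quat_defs algebra_simps)

end

lemma quat_sel [simp]:
  "qre 0 = 0" "qi 0 = 0" "qj 0 = 0" "qk 0 = 0"
  "qre 1 = 1" "qi 1 = 0" "qj 1 = 0" "qk 1 = 0"
  "qre (x + y) = qre x + qre y" "qi (x + y) = qi x + qi y"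
  "qj (x + y) = qj x + qj y" "qk (x + y) = qk x + qk y"
  "qre (- x) = - qre x" "qi (- x) = - qi x" "qj (- x) = - qj x" "qk (- x) = - qk x"
  "qre (x - y) = qre x - qre y" "qi (x - y) = qi x - qi y"
  "qj (x - y) = qj x - qj y" "qk (x - y) = qk x - qk y"
  "qre (r *\<^sub>R x) = r * qre x" "qi (r *\<^sub>R x) = r * qi x"
  "qj (r *\<^sub>R x) = r * qj x" "qk (r *\<^sub>R x) = r * qk x"
  by (simp_all add: quat_defs)

lemma quat_mult_sel [simp]:
  "qre (x * y) = qre x * qre y - qi x * qi y - qj x * qj y - qk x * qk y"
  "qi (x * y) = qre x * qi y + qi x * qre y + qj x * qk y - qk x * qj y"
  "qj (x * y) = qre x * qj y - qi x * qk y + qj x * qre y + qk x * qi y"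
  "qk (x * y) = qre x * qk y + qi x * qj y - qj x * qi y + qk x * qre y"
  by (simp_all add: quat_defs)

definition qnorm2 :: "quat \<Rightarrow> real" where
  "qnorm2 x = (qre x)\<^sup>2 + (qi x)\<^sup>2 + (qj x)\<^sup>2 + (qk x)\<^sup>2"

lemma qnorm2_mult: "qnorm2 (x * y) = qnorm2 x * qnorm2 y"
  unfolding qnorm2_def quat_mult_sel by (simp add: power2_eq_square algebra_simps)

lemma qnorm2_power: "qnorm2 (x ^ n) = qnorm2 x ^ n"
  by (induction n) (simp_all add: qnorm2_mult, simp add: qnorm2_def)

definition qcnj :: "quat \<Rightarrow> quat" where
  "qcnj x = Quat (qre x) (- qi x) (- qj x) (- qk x)"

lemma qcnj_sel [simp]:
  "qre (qcnj x) = qre x" "qi (qcnj x) = - qi x" "qj (qcnj x) = - qj x" "qk (qcnj x) = - qk x"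
  by (simp_all add: qcnj_def)

lemma qcnj_altdef: "qcnj x = (2 * qre x) *\<^sub>R 1 - x"
  by (rule quat_eqI) simp_all

lemma qnorm2_qcnj [simp]: "qnorm2 (qcnj x) = qnorm2 x"
  by (simp add: qnorm2_def)

lemma qcnj_mult_self: "qnorm2 x = 1 \<Longrightarrow> qcnj x * x = 1" "qnorm2 x = 1 \<Longrightarrow> x * qcnj x = 1"
  by (rule quat_eqI; simp add: qnorm2_def power2_eq_square algebra_simps)+

lemma quat_unit_square:
  assumes "qnorm2 x = 1"
  shows "x * x = (2 * qre x) *\<^sub>R x - 1"
proof -
  have "(2 * qre x) *\<^sub>R x - x * x = qcnj x * x"
    unfolding qcnj_altdef by (simp add: left_diff_distrib)
  then show ?thesis using qcnj_mult_self(1)[OF assms] by (simp add: algebra_simps)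
qed

text \<open>A unit quaternion is a root of \<open>t\<^sup>2 - 2 Re x t + 1\<close>, so the real parts of its powers satisfy
  the recurrence of the Chebyshev polynomials.\<close>

lemma qre_power_unit:
  assumes "qnorm2 x = 1" "qre x = cos t"
  shows "qre (x ^ n) = cos (real n * t)"
proof (induction n rule: induct_nat_012)
  case (ge2 n)
  have "x ^ Suc (Suc n) = (x * x) * x ^ n" by (simp add: mult.assoc)
  also have "\<dots> = (2 * qre x) *\<^sub>R x ^ Suc n - x ^ n"
    by (simp add: quat_unit_square[OF assms(1)] left_diff_distrib)
  finally have "qre (x ^ Suc (Suc n)) = 2 * cos t * qre (x ^ Suc n) - qre (x ^ n)"
    by (simp add: assms(2) del: quat_mult_sel power_Suc)
  also have "\<dots> = 2 * cos t * cos (real (Suc n) * t) - cos (real n * t)"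
    using ge2 by simp
  also have "\<dots> = cos (real (Suc n) * t + t)"
  proof -
    have "real n * t = real (Suc n) * t - t" by (simp add: algebra_simps)
    then show ?thesis by (simp add: cos_add cos_diff)
  qed
  finally show ?case by (simp add: algebra_simps)
qed (use assms in auto)

text \<open>The matrix of \<open>v \<mapsto> x v x\<^sup>*\<close> on the imaginary quaternions, written homogeneously, so
  that multiplicativity is a polynomial identity that holds for all quaternions.\<close>

definition rot :: "quat \<Rightarrow> real^3^3" where
  "rot x = (let a = qre x; b = qi x; c = qj x; d = qk x in vector [
     vector [a\<^sup>2 + b\<^sup>2 - c\<^sup>2 - d\<^sup>2, 2 * (b * c - a * d), 2 * (b * d + a * c)],
     vector [2 * (b * c + a * d), a\<^sup>2 - b\<^sup>2 + c\<^sup>2 - d\<^sup>2, 2 * (c * d - a * b)],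
     vector [2 * (b * d - a * c), 2 * (c * d + a * b), a\<^sup>2 - b\<^sup>2 - c\<^sup>2 + d\<^sup>2]])"

lemma rot_nth:
  "rot x $ 1 $ 1 = (qre x)\<^sup>2 + (qi x)\<^sup>2 - (qj x)\<^sup>2 - (qk x)\<^sup>2"
  "rot x $ 1 $ 2 = 2 * (qi x * qj x - qre x * qk x)"
  "rot x $ 1 $ 3 = 2 * (qi x * qk x + qre x * qj x)"
  "rot x $ 2 $ 1 = 2 * (qi x * qj x + qre x * qk x)"
  "rot x $ 2 $ 2 = (qre x)\<^sup>2 - (qi x)\<^sup>2 + (qj x)\<^sup>2 - (qk x)\<^sup>2"
  "rot x $ 2 $ 3 = 2 * (qj x * qk x - qre x * qi x)"
  "rot x $ 3 $ 1 = 2 * (qi x * qk x - qre x * qj x)"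
  "rot x $ 3 $ 2 = 2 * (qj x * qk x + qre x * qi x)"
  "rot x $ 3 $ 3 = (qre x)\<^sup>2 - (qi x)\<^sup>2 - (qj x)\<^sup>2 + (qk x)\<^sup>2"
  by (simp_all add: rot_def Let_def)

lemma mat3_eqI:
  fixes M N :: "real^3^3"
  assumes "M $ 1 $ 1 = N $ 1 $ 1" "M $ 1 $ 2 = N $ 1 $ 2" "M $ 1 $ 3 = N $ 1 $ 3"
    "M $ 2 $ 1 = N $ 2 $ 1" "M $ 2 $ 2 = N $ 2 $ 2" "M $ 2 $ 3 = N $ 2 $ 3"
    "M $ 3 $ 1 = N $ 3 $ 1" "M $ 3 $ 2 = N $ 3 $ 2" "M $ 3 $ 3 = N $ 3 $ 3"
  shows "M = N"
  using assms by (simp add: Finite_Cartesian_Product.vec_eq_iff forall_3)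

lemma mat3_mult_nth: "((M :: real^3^3) ** N) $ i $ j = M $ i $ 1 * N $ 1 $ j + M $ i $ 2 * N $ 2 $ j + M $ i $ 3 * N $ 3 $ j"
  by (simp add: matrix_matrix_mult_def sum_3)

lemma rot_mult: "rot (x * y) = rot x ** rot y"
  by (rule mat3_eqI; simp add: mat3_mult_nth rot_nth power2_eq_square algebra_simps)

lemma rot_1: "rot 1 = mat 1"
  by (rule mat3_eqI) (simp_all add: rot_nth Finite_Cartesian_Product.mat_def)

lemma rot_uminus [simp]: "rot (- x) = rot x"
  by (rule mat3_eqI) (simp_all add: rot_nth)

lemma rot_qcnj: "rot (qcnj x) = transpose (rot x)"
  by (rule mat3_eqI) (simp_all add: rot_nth Finite_Cartesian_Product.transpose_def)

lemma rot_eq_1_iff: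
  assumes "qnorm2 x = 1"
  shows "rot x = mat 1 \<longleftrightarrow> x = 1 \<or> x = - 1"
proof
  assume "rot x = mat 1"
  then have eq: "rot x $ i $ j = mat 1 $ i $ j" for i j by simp
  have n: "(qre x)\<^sup>2 + (qi x)\<^sup>2 + (qj x)\<^sup>2 + (qk x)\<^sup>2 = 1" using assms by (simp add: qnorm2_def)
  have "(qre x)\<^sup>2 + (qi x)\<^sup>2 - (qj x)\<^sup>2 - (qk x)\<^sup>2 = 1"
    "(qre x)\<^sup>2 - (qi x)\<^sup>2 + (qj x)\<^sup>2 - (qk x)\<^sup>2 = 1"
    "(qre x)\<^sup>2 - (qi x)\<^sup>2 - (qj x)\<^sup>2 + (qk x)\<^sup>2 = 1"
    using eq[of 1 1] eq[of 2 2] eq[of 3 3] by (simp_all add: rot_nth Finite_Cartesian_Product.mat_def)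
  with n have "(qi x)\<^sup>2 = 0" "(qj x)\<^sup>2 = 0" "(qk x)\<^sup>2 = 0" "(qre x)\<^sup>2 = 1" by linarith+
  then show "x = 1 \<or> x = - 1" by (auto simp: quat_eq_iff power2_eq_1_iff)
next
  show "x = 1 \<or> x = - 1 \<Longrightarrow> rot x = mat 1" by (auto simp: rot_1)
qed

text \<open>The unit quaternions cover the rotations twice.\<close>

lemma rot_eq_iff:
  assumes "qnorm2 x = 1" "qnorm2 y = 1"
  shows "rot x = rot y \<longleftrightarrow> x = y \<or> x = - y"
proof
  assume "rot x = rot y"
  then have "rot (qcnj y * x) = rot (qcnj y * y)" by (simp add: rot_mult)
  then have "qcnj y * x = 1 \<or> qcnj y * x = - 1"
    using assms rot_eq_1_iff[of "qcnj y * x"] by (simp add: qcnj_mult_self qnorm2_mult rot_1)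
  then have "y * (qcnj y * x) = y * 1 \<or> y * (qcnj y * x) = y * (- 1)" by metis
  then show "x = y \<or> x = - y"
    using qcnj_mult_self(2)[OF assms(2)] by (simp flip: mult.assoc)
next
  show "x = y \<or> x = - y \<Longrightarrow> rot x = rot y" by auto
qed

lemma SO3_sel [simp]: "carrier SO3 = {M. orthogonal_matrix M \<and> Determinants.det M = 1}"
  "mult SO3 = (**)" "one SO3 = mat 1"
  by (simp_all add: SO3_def)

lemma group_SO3: "group SO3"
proof (rule groupI)
  fix M assume M: "M \<in> carrier SO3"
  then have "transpose M \<in> carrier SO3" "transpose M ** M = mat 1"
    by (auto simp: det_transpose orthogonal_matrix_def)
  then show "\<exists>N\<in>carrier SO3. N \<otimes>\<^bsub>SO3\<^esub> M = \<one>\<^bsub>SO3\<^esub>"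
    by (intro bexI[of _ "transpose M"]) simp_all
qed (auto simp: orthogonal_matrix_mul det_mul matrix_mul_assoc orthogonal_matrix_id)

lemma rot_in_SO3:
  assumes "qnorm2 x = 1"
  shows "rot x \<in> carrier SO3"
proof -
  have "transpose (rot x) ** rot x = mat 1"
    by (simp add: rot_qcnj[symmetric] rot_mult[symmetric] qcnj_mult_self assms rot_1)
  moreover have "Determinants.det (rot x) = qnorm2 x ^ 3"
    unfolding det_3 rot_nth qnorm2_def
    by (simp add: power2_eq_square power3_eq_cube algebra_simps)
  ultimately show ?thesis using assms by (simp add: orthogonal_matrix)
qed

lemma inv_rot:
  assumes "qnorm2 x = 1"
  shows "inv\<^bsub>SO3\<^esub> rot x = rot (qcnj x)"
proof (rule group.inv_equality[OF group_SO3])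
  show "rot (qcnj x) \<otimes>\<^bsub>SO3\<^esub> rot x = \<one>\<^bsub>SO3\<^esub>"
    by (simp add: rot_mult[symmetric] qcnj_mult_self assms rot_1)
qed (use assms rot_in_SO3 in auto)

lemma rot_power: "rot x [^]\<^bsub>SO3\<^esub> (n::nat) = rot (x ^ n)"
proof (induction n)
  case (Suc n)
  have "rot x [^]\<^bsub>SO3\<^esub> Suc n = rot (x ^ n) ** rot x"
    using Suc by (simp add: nat_pow_def)
  then show ?case by (simp add: rot_mult[symmetric] power_commutes)
qed (simp add: nat_pow_def rot_1)


section \<open>The Gram determinant of two rotations\<close>

text \<open>Lifts of the two rotations of the theorem: rotations by \<open>2 \<alpha>\<close> about the first coordinate axis
  and by \<open>2 \<beta>\<close> about the axis \<open>(cos \<phi>, - sin \<phi>, 0)\<close>, which is the image of the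
  first axis under \<open>Umat \<phi>\<close>.\<close>

definition xquat :: "real \<Rightarrow> quat" where
  "xquat \<alpha> = Quat (cos \<alpha>) (sin \<alpha>) 0 0"

definition xyquat :: "real \<Rightarrow> real \<Rightarrow> quat" where
  "xyquat \<phi> \<beta> = Quat (cos \<beta>) (sin \<beta> * cos \<phi>) (- sin \<beta> * sin \<phi>) 0"

lemma qnorm2_xquat: "qnorm2 (xquat \<alpha>) = 1"
  by (simp add: qnorm2_def xquat_def)

lemma qnorm2_xyquat: "qnorm2 (xyquat \<phi> \<beta>) = 1"
proof -
  have "qnorm2 (xyquat \<phi> \<beta>) = (cos \<beta>)\<^sup>2 + (sin \<beta>)\<^sup>2 * ((cos \<phi>)\<^sup>2 + (sin \<phi>)\<^sup>2)"
    by (simp add: qnorm2_def xyquat_def power_mult_distrib distrib_left del: sin_cos_squared_add2)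
  then show ?thesis by simp
qed

lemma Cmat_eq_rot: "Cmat \<theta> = rot (xquat (\<theta> / 2))"
proof -
  have "cos \<theta> = (cos (\<theta> / 2))\<^sup>2 - (sin (\<theta> / 2))\<^sup>2" "sin \<theta> = 2 * sin (\<theta> / 2) * cos (\<theta> / 2)"
    using cos_double[of "\<theta> / 2"] sin_double[of "\<theta> / 2"] by simp_all
  then show ?thesis
    by (intro mat3_eqI) (simp_all add: Cmat_def rot_nth xquat_def)
qed

lemma Umat_eq_rot: "Umat \<phi> = rot (Quat (cos (\<phi> / 2)) 0 0 (- sin (\<phi> / 2)))"
proof -
  have "cos \<phi> = (cos (\<phi> / 2))\<^sup>2 - (sin (\<phi> / 2))\<^sup>2" "sin \<phi> = 2 * sin (\<phi> / 2) * cos (\<phi> / 2)"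
    using cos_double[of "\<phi> / 2"] sin_double[of "\<phi> / 2"] by simp_all
  then show ?thesis
    by (intro mat3_eqI) (simp_all add: Umat_def rot_nth)
qed

lemma conjugate_Cmat_eq_rot: "Umat \<phi> ** Cmat \<theta> ** transpose (Umat \<phi>) = rot (xyquat \<phi> (\<theta> / 2))"
proof -
  define u where "u = Quat (cos (\<phi> / 2)) 0 0 (- sin (\<phi> / 2))"
  have c: "cos \<phi> = (cos (\<phi> / 2))\<^sup>2 - (sin (\<phi> / 2))\<^sup>2" "sin \<phi> = 2 * sin (\<phi> / 2) * cos (\<phi> / 2)"
    using cos_double[of "\<phi> / 2"] sin_double[of "\<phi> / 2"] by simp_all
  have "C * t * C + S * t * S = t * (C\<^sup>2 + S\<^sup>2)" "C * t * C - S * t * S = t * (C\<^sup>2 - S\<^sup>2)"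
    for C S t :: real
    by (simp_all add: power2_eq_square algebra_simps)
  note 1 = this[of "cos (\<phi> / 2)" _ "sin (\<phi> / 2)"]
  have "u * xquat (\<theta> / 2) * qcnj u = xyquat \<phi> (\<theta> / 2)"
    by (rule quat_eqI) (simp_all add: u_def xquat_def xyquat_def c 1)
  then have "rot (u * xquat (\<theta> / 2) * qcnj u) = rot (xyquat \<phi> (\<theta> / 2))" by simp
  then show ?thesis by (simp add: rot_mult rot_qcnj Cmat_eq_rot Umat_eq_rot u_def)
qed

text \<open>Some power of \<open>x\<close> is \<open>1\<close> or \<open>-1\<close>, so \<open>Re x\<close> is the cosine of
  a rational multiple of \<open>\<pi>\<close>.\<close>

lemma algebraic_int_2qre_of_finite_order:
  assumes x: "qnorm2 x = 1" and fin: "\<not> infinite_order SO3 (rot x)"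
  shows "algebraic_int (2 * qre x)"
proof -
  obtain n :: nat where n: "n > 0" "rot (x ^ n) = mat 1"
    using fin by (auto simp: infinite_order_def rot_power)
  then have "x ^ n = 1 \<or> x ^ n = - 1"
    using x by (simp add: rot_eq_1_iff qnorm2_power)
  moreover have "\<bar>qre x\<bar> \<le> 1"
    using x unfolding qnorm2_def by (subst abs_square_le_1[symmetric]) (smt (verit) zero_le_power2)
  then have "qre x = cos (arccos (qre x))" by (simp add: cos_arccos abs_le_iff)
  ultimately show ?thesis
    using qre_power_unit[OF x, of "arccos (qre x)" n] algebraic_int_2cos[of n "arccos (qre x)"] n(1)
    by auto
qed

text \<open>The left-hand side is four times the Gram determinant of \<open>1\<close>, the conjugate of the first quaternion,
  and the second quaternion. Their mutual inner products are the three real parts. The determinant is also the squared volume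
  that these vectors span, which gives the right-hand side.\<close>

lemma gram_identity:
  fixes \<alpha> \<beta> \<phi> :: real
  defines "x \<equiv> 2 * cos \<alpha>" and "y \<equiv> 2 * cos \<beta>" and "z \<equiv> 2 * qre (xquat \<alpha> * xyquat \<phi> \<beta>)"
  shows "4 - (x\<^sup>2 + y\<^sup>2 + z\<^sup>2 - x * y * z) = 4 * (sin \<alpha>)\<^sup>2 * (sin \<beta>)\<^sup>2 * (sin \<phi>)\<^sup>2"
proof -
  have z: "z = 2 * (cos \<alpha> * cos \<beta> - sin \<alpha> * (sin \<beta> * cos \<phi>))"
    by (simp add: z_def xquat_def xyquat_def)
  have "4 - (x\<^sup>2 + y\<^sup>2 + z\<^sup>2 - x * y * z) = 4 * (1 - (cos \<alpha>)\<^sup>2) * (1 - (cos \<beta>)\<^sup>2)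
      - 4 * (sin \<alpha>)\<^sup>2 * (sin \<beta>)\<^sup>2 * (cos \<phi>)\<^sup>2"
    unfolding x_def y_def z by (simp add: algebra_simps power2_eq_square)
  also have "\<dots> = 4 * (sin \<alpha>)\<^sup>2 * (sin \<beta>)\<^sup>2 * (sin \<phi>)\<^sup>2"
    unfolding sin_squared_eq by (simp add: algebra_simps)
  finally show ?thesis .
qed

lemma sin_half_squared: "2 * (sin (\<theta> / 2))\<^sup>2 = 1 - cos \<theta>" for \<theta> :: real
  using cos_double_sin[of "\<theta> / 2"] by simp

lemma gram_integral_of_finite_order:
  assumes "algebraic_int (2 * cos (a / 2))" "algebraic_int (2 * cos (b / 2))"
    and "\<not> infinite_order SO3 (rot (xquat (a / 2) * xyquat \<phi> (b / 2)))"
  shows "algebraic_int ((1 - cos a) * (1 - cos b) * (1 - (cos \<phi>)\<^sup>2))"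
proof -
  let ?x = "2 * cos (a / 2)" and ?y = "2 * cos (b / 2)"
    and ?z = "2 * qre (xquat (a / 2) * xyquat \<phi> (b / 2))"
  have "algebraic_int ?z"
    using assms(3) by (intro algebraic_int_2qre_of_finite_order)
      (simp_all add: qnorm2_mult qnorm2_xquat qnorm2_xyquat)
  with assms(1,2) have "algebraic_int (4 - (?x\<^sup>2 + ?y\<^sup>2 + ?z\<^sup>2 - ?x * ?y * ?z))"
    by (intro algebraic_int_diff_real algebraic_int_add_real algebraic_int_power_real
        algebraic_int_numeral algebraic_int_mult_real[OF algebraic_int_mult_real])
  also have "4 - (?x\<^sup>2 + ?y\<^sup>2 + ?z\<^sup>2 - ?x * ?y * ?z)
      = (2 * (sin (a / 2))\<^sup>2) * (2 * (sin (b / 2))\<^sup>2) * (sin \<phi>)\<^sup>2"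
    unfolding gram_identity by simp
  finally show ?thesis unfolding sin_half_squared by (simp add: sin_squared_eq)
qed

text \<open>Write \<open>p q = w + u + m\<close> and \<open>q p = w + u - m\<close> with \<open>u\<close> in the plane of the
  two axes and \<open>m\<close> perpendicular to it. These commute as quaternions only if \<open>u \<times> m = 0\<close>,
  and anticommute only if \<open>w u = 0\<close>. Here \<open>m\<close> is nonzero because the axes differ, \<open>u\<close>
  is nonzero unless both rotations are half turns, and \<open>w = 0\<close> would make \<open>p q\<close> a half
  turn.\<close>

lemma infinite_order_products_do_not_commute:
  assumes \<phi>: "sin \<phi> > 0" and \<alpha>: "sin \<alpha> > 0" and \<beta>: "sin \<beta> > 0" and ne: "cos \<alpha> \<noteq> 0 \<or> cos \<beta> \<noteq> 0"
    and inf: "infinite_order SO3 (rot (xquat \<alpha> * xyquat \<phi> \<beta>))"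
  shows "rot ((xquat \<alpha> * xyquat \<phi> \<beta>) * (xyquat \<phi> \<beta> * xquat \<alpha>))
       \<noteq> rot ((xyquat \<phi> \<beta> * xquat \<alpha>) * (xquat \<alpha> * xyquat \<phi> \<beta>))"
proof
  define p q where pq: "p = xquat \<alpha>" "q = xyquat \<phi> \<beta>"
  have n: "qnorm2 p = 1" "qnorm2 q = 1" by (simp_all add: pq qnorm2_xquat qnorm2_xyquat)
  define w where "w = qre (p * q)"
  define ux where "ux = cos \<alpha> * (sin \<beta> * cos \<phi>) + cos \<beta> * sin \<alpha>"
  define uy where "uy = - (cos \<alpha> * (sin \<beta> * sin \<phi>))"
  define m where "m = - (sin \<alpha> * (sin \<beta> * sin \<phi>))"
  have 1: "p * q = Quat w ux uy m" "q * p = Quat w ux uy (- m)"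
    by (simp_all add: quat_eq_iff w_def ux_def uy_def m_def pq xquat_def xyquat_def algebra_simps)
  have "m \<noteq> 0" using assms by (simp add: m_def)
  have u: "ux \<noteq> 0 \<or> uy \<noteq> 0"
  proof (cases "cos \<alpha> = 0")
    case True
    then show ?thesis using ne \<alpha> by (simp add: ux_def)
  qed (use \<phi> \<beta> in \<open>simp add: uy_def\<close>)
  have "w \<noteq> 0"
  proof
    assume "w = 0"
    then have "(p * q) * (p * q) = - 1"
      using quat_unit_square[of "p * q"] n by (simp add: w_def qnorm2_mult)
    then have "rot ((p * q) ^ 2) = mat 1"
      using n by (simp add: rot_1 power2_eq_square)
    then show False
      using inf unfolding infinite_order_def pq[symmetric] rot_power SO3_sel
      by (metis pos2)
  qed
  \<comment> \<open>Equality of rotations means equality of the lifts up to sign, hence the two cases.\<close>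
  assume "rot ((xquat \<alpha> * xyquat \<phi> \<beta>) * (xyquat \<phi> \<beta> * xquat \<alpha>))
       = rot ((xyquat \<phi> \<beta> * xquat \<alpha>) * (xquat \<alpha> * xyquat \<phi> \<beta>))"
  then have "(p * q) * (q * p) = (q * p) * (p * q) \<or> (p * q) * (q * p) = - ((q * p) * (p * q))"
    using rot_eq_iff[of "(p * q) * (q * p)" "(q * p) * (p * q)"] n
    by (simp add: pq qnorm2_mult)
  then show False
  proof
    assume "(p * q) * (q * p) = (q * p) * (p * q)"
    then show False using u \<open>m \<noteq> 0\<close> unfolding 1 quat_eq_iff by simp
  next
    assume "(p * q) * (q * p) = - ((q * p) * (p * q))"
    then show False using u \<open>w \<noteq> 0\<close> unfolding 1 quat_eq_iff by simp
  qed
qed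

lemma infinite_order_swap:
  assumes p: "qnorm2 p = 1" and "infinite_order SO3 (rot (p * q))"
  shows "infinite_order SO3 (rot (q * p))"
  unfolding infinite_order_def rot_power
proof (intro allI impI notI)
  fix n :: nat assume n: "n > 0" and "rot ((q * p) ^ n) = \<one>\<^bsub>SO3\<^esub>"
  have "p * (q * p) ^ n = (p * q) ^ n * p"
  proof (induction n)
    case (Suc n)
    have "p * (q * p) ^ Suc n = (p * q) * (p * (q * p) ^ n)" by (simp add: mult.assoc)
    also have "\<dots> = (p * q) * ((p * q) ^ n * p)" unfolding Suc ..
    finally show ?case by (simp add: mult.assoc)
  qed simp
  then have "(p * q) ^ n = p * (q * p) ^ n * qcnj p"
    by (simp add: mult.assoc qcnj_mult_self p)
  then have "rot ((p * q) ^ n) = rot p ** rot (qcnj p)"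
    using \<open>rot ((q * p) ^ n) = _\<close> by (simp add: rot_mult)
  also have "\<dots> = mat 1" by (simp add: rot_mult[symmetric] qcnj_mult_self p rot_1)
  finally show False using assms(2) n by (simp add: infinite_order_def rot_power)
qed


section \<open>Finite rotation groups from conjugate lattices\<close>

text \<open>The ring \<open>\<int>[\<gamma>]\<close>, embedded in the plane by its two real embeddings \<open>\<gamma>
  \<mapsto> \<gamma>\<close> and \<open>\<gamma> \<mapsto> \<gamma>'\<close>. Pairs are used in place of a conjugation map,
  so that no irrationality of \<open>\<gamma>\<close> enters.\<close>

definition quadratic_pairs :: "real \<Rightarrow> real \<Rightarrow> (real \<times> real) set" where
  "quadratic_pairs \<gamma> \<gamma>' = {(of_int m + of_int n * \<gamma>, of_int m + of_int n * \<gamma>') | m n. True}"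

lemma quadratic_pairsI:
  "c = of_int m + of_int n * \<gamma> \<Longrightarrow> c' = of_int m + of_int n * \<gamma>' \<Longrightarrow> (c, c') \<in> quadratic_pairs \<gamma> \<gamma>'"
  by (auto simp: quadratic_pairs_def)

lemma quadratic_pairs_diff:
  assumes "(c, c') \<in> quadratic_pairs \<gamma> \<gamma>'" "(d, d') \<in> quadratic_pairs \<gamma> \<gamma>'"
  shows "(c - d, c' - d') \<in> quadratic_pairs \<gamma> \<gamma>'"
proof -
  obtain m n k l where "c = of_int m + of_int n * \<gamma>" "c' = of_int m + of_int n * \<gamma>'"
    "d = of_int k + of_int l * \<gamma>" "d' = of_int k + of_int l * \<gamma>'"
    using assms by (auto simp: quadratic_pairs_def)
  then show ?thesis by (intro quadratic_pairsI[of _ "m - k" "n - l"]) (simp_all add: algebra_simps)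
qed

lemma quadratic_pairs_0: "(0, 0) \<in> quadratic_pairs \<gamma> \<gamma>'"
  by (rule quadratic_pairsI[of _ 0 0]) simp_all

lemma quadratic_pairs_1: "(1, 1) \<in> quadratic_pairs \<gamma> \<gamma>'"
  by (rule quadratic_pairsI[of _ 1 0]) simp_all

lemma quadratic_pairs_uminus:
  assumes "(c, c') \<in> quadratic_pairs \<gamma> \<gamma>'"
  shows "(- c, - c') \<in> quadratic_pairs \<gamma> \<gamma>'"
  using quadratic_pairs_diff[OF quadratic_pairs_0 assms] by simp

lemma quadratic_pairs_add:
  assumes "(c, c') \<in> quadratic_pairs \<gamma> \<gamma>'" "(d, d') \<in> quadratic_pairs \<gamma> \<gamma>'"
  shows "(c + d, c' + d') \<in> quadratic_pairs \<gamma> \<gamma>'"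
  using quadratic_pairs_diff[OF assms(1) quadratic_pairs_uminus[OF assms(2)]] by simp

lemma quadratic_pairs_mult:
  assumes \<gamma>: "\<gamma>\<^sup>2 = of_int u * \<gamma> + of_int v" "\<gamma>'\<^sup>2 = of_int u * \<gamma>' + of_int v"
    and "(c, c') \<in> quadratic_pairs \<gamma> \<gamma>'" "(d, d') \<in> quadratic_pairs \<gamma> \<gamma>'"
  shows "(c * d, c' * d') \<in> quadratic_pairs \<gamma> \<gamma>'"
proof -
  obtain m n k l where cd: "c = of_int m + of_int n * \<gamma>" "c' = of_int m + of_int n * \<gamma>'"
    "d = of_int k + of_int l * \<gamma>" "d' = of_int k + of_int l * \<gamma>'"
    using assms by (auto simp: quadratic_pairs_def)
  have mul: "(of_int m + of_int n * t) * (of_int k + of_int l * t)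
      = of_int (m * k + n * l * v) + of_int (m * l + n * k + n * l * u) * t"
    if "t\<^sup>2 = of_int u * t + of_int v" for t :: real
  proof -
    have "(of_int m + of_int n * t) * (of_int k + of_int l * t)
      = of_int m * of_int k + (of_int m * of_int l + of_int n * of_int k) * t + of_int n * of_int l * t\<^sup>2"
      by (simp add: algebra_simps power2_eq_square)
    also have "\<dots> = of_int (m * k + n * l * v) + of_int (m * l + n * k + n * l * u) * t"
      unfolding that by (simp add: algebra_simps)
    finally show ?thesis .
  qed
  show ?thesis
    unfolding cd mul[OF \<gamma>(1)] mul[OF \<gamma>(2)] by (rule quadratic_pairsI) (rule refl)+
qed

text \<open>\<open>\<int>[\<gamma>]\<close> is discrete in the plane: the coordinate of \<open>\<gamma>\<close> is the
  difference of the two embeddings divided by \<open>\<gamma> - \<gamma>'\<close>.\<close>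

lemma finite_bounded_quadratic_pairs:
  assumes "\<gamma> \<noteq> \<gamma>'"
  shows "finite {z \<in> quadratic_pairs \<gamma> \<gamma>'. \<bar>fst z\<bar> \<le> K \<and> \<bar>snd z\<bar> \<le> K}"
proof -
  define N where "N = 2 * K / \<bar>\<gamma> - \<gamma>'\<bar>"
  define M where "M = K + N * \<bar>\<gamma>\<bar>"
  let ?B = "\<lambda>r :: real. {i :: int. \<bar>real_of_int i\<bar> \<le> r}"
  have fin: "finite (?B r)" for r
  proof (rule finite_subset[of _ "{- \<lfloor>r\<rfloor>..\<lfloor>r\<rfloor>}"])
    have "- i \<le> \<lfloor>r\<rfloor> \<and> i \<le> \<lfloor>r\<rfloor>" if "\<bar>real_of_int i\<bar> \<le> r" for i
      using that by (simp add: le_floor_iff abs_le_iff)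
    then show "?B r \<subseteq> {- \<lfloor>r\<rfloor>..\<lfloor>r\<rfloor>}" by force
  qed simp
  have "{z \<in> quadratic_pairs \<gamma> \<gamma>'. \<bar>fst z\<bar> \<le> K \<and> \<bar>snd z\<bar> \<le> K}
      \<subseteq> (\<lambda>(m, n). (of_int m + of_int n * \<gamma>, of_int m + of_int n * \<gamma>')) ` (?B M \<times> ?B N)"
  proof safe
    fix c c' assume "(c, c') \<in> quadratic_pairs \<gamma> \<gamma>'" and K: "\<bar>fst (c, c')\<bar> \<le> K" "\<bar>snd (c, c')\<bar> \<le> K"
    then obtain m n where c: "c = of_int m + of_int n * \<gamma>" "c' = of_int m + of_int n * \<gamma>'"
      by (auto simp: quadratic_pairs_def)
    have "\<bar>of_int n\<bar> * \<bar>\<gamma> - \<gamma>'\<bar> = \<bar>c - c'\<bar>" by (simp add: c right_diff_distrib flip: abs_mult)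
    also have "\<dots> \<le> 2 * K" using K by simp
    finally have n: "\<bar>of_int n\<bar> \<le> N" using assms by (simp add: N_def field_simps)
    have "of_int m = c - of_int n * \<gamma>" by (simp add: c)
    then have "\<bar>of_int m\<bar> \<le> \<bar>c\<bar> + \<bar>of_int n\<bar> * \<bar>\<gamma>\<bar>" by (metis abs_mult abs_triangle_ineq4)
    also have "\<dots> \<le> M" using K n unfolding M_def by (intro add_mono mult_right_mono) auto
    finally show "(c, c') \<in> (\<lambda>(m, n). (of_int m + of_int n * \<gamma>, of_int m + of_int n * \<gamma>')) ` (?B M \<times> ?B N)"
      using n c by (auto intro!: image_eqI[of _ _ "(m, n)"])
  qed
  then show ?thesis by (rule finite_subset) (intro finite_imageI finite_cartesian_product fin)
qed

definition qcomb :: "quat \<Rightarrow> quat \<Rightarrow> real \<Rightarrow> real \<Rightarrow> real \<Rightarrow> real \<Rightarrow> quat" where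
  "qcomb p q c0 c1 c2 c3 = c0 *\<^sub>R 1 + c1 *\<^sub>R p + c2 *\<^sub>R q + c3 *\<^sub>R (p * q)"

text \<open>The combinations of \<open>1, p, q, p q\<close> over a ring that contains the three traces are closed under left
  multiplication by \<open>p\<close> and \<open>q\<close>. The coefficients come from \<open>p\<^sup>2 = x p - 1\<close>,
  \<open>q\<^sup>2 = y q - 1\<close>, \<open>q p = (z - x y) + y p + x q - p q\<close> and \<open>q p q = z q - x +
  p\<close>, where \<open>x\<close>, \<open>y\<close>, \<open>z\<close> are the traces of \<open>p\<close>, \<open>q\<close>,
  \<open>p q\<close>.\<close>

lemma mult_qcomb_left:
  assumes "qnorm2 p = 1"
  shows "p * qcomb p q c0 c1 c2 c3
    = qcomb p q (- c1) (c0 + 2 * qre p * c1) (- c3) (c2 + 2 * qre p * c3)"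
proof -
  have "p * qcomb p q c0 c1 c2 c3 = c0 *\<^sub>R p + c1 *\<^sub>R (p * p) + c2 *\<^sub>R (p * q) + c3 *\<^sub>R ((p * p) * q)"
    by (simp add: qcomb_def algebra_simps)
  then show ?thesis
    by (simp add: quat_unit_square[OF assms] qcomb_def algebra_simps)
qed

lemma mult_qcomb_right:
  assumes "qnorm2 q = 1"
  shows "q * qcomb p q c0 c1 c2 c3
    = qcomb p q (c1 * (2 * qre (p * q) - (2 * qre p) * (2 * qre q)) - c2 - 2 * qre p * c3)
        (2 * qre q * c1 + c3) (c0 + 2 * qre p * c1 + 2 * qre q * c2 + 2 * qre (p * q) * c3) (- c1)"
proof -
  define x y z where "x = 2 * qre p" and "y = 2 * qre q" and "z = 2 * qre (p * q)"
  have qp: "q * p = (z - x * y) *\<^sub>R 1 + y *\<^sub>R p + x *\<^sub>R q - p * q"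
    by (rule quat_eqI) (simp_all add: x_def y_def z_def algebra_simps)
  have qq: "q * q = y *\<^sub>R q - 1" by (simp add: quat_unit_square[OF assms] y_def)
  have "q * p * q = (z - x * y) *\<^sub>R q + y *\<^sub>R (p * q) + x *\<^sub>R (q * q) - p * (q * q)"
    unfolding qp by (simp add: algebra_simps)
  also have "\<dots> = z *\<^sub>R q - x *\<^sub>R 1 + p"
    unfolding qq by (simp add: algebra_simps)
  finally have qpq: "q * p * q = z *\<^sub>R q - x *\<^sub>R 1 + p" .
  have "q * qcomb p q c0 c1 c2 c3 = c0 *\<^sub>R q + c1 *\<^sub>R (q * p) + c2 *\<^sub>R (q * q) + c3 *\<^sub>R (q * p * q)"
    by (simp add: qcomb_def algebra_simps)
  also have "\<dots> = qcomb p q (c1 * (z - x * y) - c2 - x * c3) (y * c1 + c3) (c0 + x * c1 + y * c2 + z * c3) (- c1)"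
    unfolding qpq unfolding qp qq by (simp add: qcomb_def algebra_simps)
  finally show ?thesis unfolding x_def y_def z_def .
qed

text \<open>In these coordinates \<open>1, p, q, p q\<close> is a triangular basis, so the coefficients are obtained one
  after the other, starting from the last.\<close>

lemma qcomb_coefficients_bounded:
  assumes p: "qi p \<noteq> 0" "qj p = 0" "qk p = 0" and q: "qj q \<noteq> 0" "qk q = 0"
  obtains K where "\<And>c0 c1 c2 c3. qnorm2 (qcomb p q c0 c1 c2 c3) = 1 \<Longrightarrow>
    \<bar>c0\<bar> \<le> K \<and> \<bar>c1\<bar> \<le> K \<and> \<bar>c2\<bar> \<le> K \<and> \<bar>c3\<bar> \<le> K"
proof -
  define r t where "r = qi (p * q)" and "t = qre (p * q)"
  define K3 where "K3 = 1 / \<bar>qi p * qj q\<bar>"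
  define K2 where "K2 = 1 / \<bar>qj q\<bar> + K3 * \<bar>qre p\<bar>"
  define K1 where "K1 = (1 + K2 * \<bar>qi q\<bar> + K3 * \<bar>r\<bar>) / \<bar>qi p\<bar>"
  define K0 where "K0 = 1 + K1 * \<bar>qre p\<bar> + K2 * \<bar>qre q\<bar> + K3 * \<bar>t\<bar>"
  have "\<bar>c0\<bar> \<le> K0 \<and> \<bar>c1\<bar> \<le> K1 \<and> \<bar>c2\<bar> \<le> K2 \<and> \<bar>c3\<bar> \<le> K3"
    if "qnorm2 (qcomb p q c0 c1 c2 c3) = 1" for c0 c1 c2 c3
  proof -
    define g where "g = qcomb p q c0 c1 c2 c3"
    have "(qre g)\<^sup>2 + (qi g)\<^sup>2 + (qj g)\<^sup>2 + (qk g)\<^sup>2 = 1" using that by (simp add: g_def qnorm2_def)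
    then have "(qre g)\<^sup>2 \<le> 1" "(qi g)\<^sup>2 \<le> 1" "(qj g)\<^sup>2 \<le> 1" "(qk g)\<^sup>2 \<le> 1"
      by (smt (verit) zero_le_power2)+
    then have le1: "\<bar>qre g\<bar> \<le> 1" "\<bar>qi g\<bar> \<le> 1" "\<bar>qj g\<bar> \<le> 1" "\<bar>qk g\<bar> \<le> 1"
      by (simp_all add: abs_square_le_1)
    have g: "qk g = c3 * (qi p * qj q)" "qj g = (c2 + c3 * qre p) * qj q"
      "qi g = c1 * qi p + c2 * qi q + c3 * r" "qre g = c0 + c1 * qre p + c2 * qre q + c3 * t"
      using p q by (simp_all add: g_def qcomb_def r_def t_def algebra_simps)
    have "c3 = qk g / (qi p * qj q)" using p q by (simp add: g)
    then have 3: "\<bar>c3\<bar> \<le> K3" using le1 by (simp add: K3_def divide_right_mono)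
    have "c2 = qj g / qj q - c3 * qre p" using q by (simp add: g)
    then have "\<bar>c2\<bar> \<le> \<bar>qj g / qj q\<bar> + \<bar>c3\<bar> * \<bar>qre p\<bar>" by (metis abs_mult abs_triangle_ineq4)
    also have "\<dots> \<le> K2" unfolding K2_def using 3 le1
      by (intro add_mono mult_right_mono) (auto simp: divide_right_mono)
    finally have 2: "\<bar>c2\<bar> \<le> K2" .
    have "c1 * qi p = qi g - c2 * qi q - c3 * r" by (simp add: g)
    then have "\<bar>c1\<bar> * \<bar>qi p\<bar> \<le> \<bar>qi g\<bar> + \<bar>c2\<bar> * \<bar>qi q\<bar> + \<bar>c3\<bar> * \<bar>r\<bar>"
      unfolding abs_mult[symmetric] by linarith
    also have "\<dots> \<le> 1 + K2 * \<bar>qi q\<bar> + K3 * \<bar>r\<bar>" using 2 3 le1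
      by (intro add_mono mult_right_mono) auto
    finally have 1: "\<bar>c1\<bar> \<le> K1" using p(1) by (simp add: K1_def field_simps)
    have "\<bar>c0\<bar> \<le> \<bar>qre g\<bar> + \<bar>c1\<bar> * \<bar>qre p\<bar> + \<bar>c2\<bar> * \<bar>qre q\<bar> + \<bar>c3\<bar> * \<bar>t\<bar>"
      unfolding abs_mult[symmetric] g by linarith
    also have "\<dots> \<le> K0" unfolding K0_def using 1 2 3 le1
      by (intro add_mono mult_right_mono) auto
    finally show ?thesis using 1 2 3 by blast
  qed
  then show ?thesis by (intro that[of "max (max K0 K1) (max K2 K3)"]) (meson le_max_iff_disj)
qed

text \<open>Two pairs of unit quaternions whose traces are conjugate under the two embeddings of
  \<open>\<int>[\<gamma>]\<close>; the conditions on the components say that \<open>1, p, q, p q\<close> and \<open>1, p',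
  q', p' q'\<close> are bases. The correspondence of combinations with conjugate coefficients is the Galois conjugation
  between two definite quaternion algebras.\<close>

locale conjugate_pair =
  fixes \<gamma> \<gamma>' :: real and u v :: int and p q p' q' :: quat
  assumes \<gamma>: "\<gamma>\<^sup>2 = of_int u * \<gamma> + of_int v" "\<gamma>'\<^sup>2 = of_int u * \<gamma>' + of_int v" "\<gamma> \<noteq> \<gamma>'"
    and unit: "qnorm2 p = 1" "qnorm2 q = 1" "qnorm2 p' = 1" "qnorm2 q' = 1"
    and tr: "(2 * qre p, 2 * qre p') \<in> quadratic_pairs \<gamma> \<gamma>'"
      "(2 * qre q, 2 * qre q') \<in> quadratic_pairs \<gamma> \<gamma>'"
      "(2 * qre (p * q), 2 * qre (p' * q')) \<in> quadratic_pairs \<gamma> \<gamma>'"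
    and pos: "qi p \<noteq> 0" "qj p = 0" "qk p = 0" "qj q \<noteq> 0" "qk q = 0"
    and pos': "qi p' \<noteq> 0" "qj p' = 0" "qk p' = 0" "qj q' \<noteq> 0" "qk q' = 0"
begin

abbreviation "R \<equiv> quadratic_pairs \<gamma> \<gamma>'"

definition lattice :: "(quat \<times> quat) set" where
  "lattice = {(qcomb p q c0 c1 c2 c3, qcomb p' q' c0' c1' c2' c3') | c0 c1 c2 c3 c0' c1' c2' c3'.
     (c0, c0') \<in> R \<and> (c1, c1') \<in> R \<and> (c2, c2') \<in> R \<and> (c3, c3') \<in> R}"

lemmas R_closed = quadratic_pairs_0 quadratic_pairs_1 quadratic_pairs_uminus quadratic_pairs_add
  quadratic_pairs_diff quadratic_pairs_mult[OF \<gamma>(1,2)] tr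

lemma lattice_mult:
  assumes "(g, g') \<in> lattice"
  shows "(p * g, p' * g') \<in> lattice" "(q * g, q' * g') \<in> lattice"
proof -
  obtain c0 c1 c2 c3 c0' c1' c2' c3' where g: "g = qcomb p q c0 c1 c2 c3" "g' = qcomb p' q' c0' c1' c2' c3'"
    and c: "(c0, c0') \<in> R" "(c1, c1') \<in> R" "(c2, c2') \<in> R" "(c3, c3') \<in> R"
    using assms unfolding lattice_def by blast
  show "(p * g, p' * g') \<in> lattice"
    unfolding g mult_qcomb_left[OF unit(1)] mult_qcomb_left[OF unit(3)] lattice_def mem_Collect_eq prod.inject
    by (intro exI conjI; (rule refl)?; intro R_closed c)
  show "(q * g, q' * g') \<in> lattice"
    unfolding g mult_qcomb_right[OF unit(2)] mult_qcomb_right[OF unit(4)] lattice_def mem_Collect_eq prod.inject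
    by (intro exI conjI; (rule refl)?; intro R_closed c)
qed

lemma lattice_qcnj_mult:
  assumes "(g, g') \<in> lattice" "(a * g, a' * g') \<in> lattice" "(2 * qre a, 2 * qre a') \<in> R"
  shows "(qcnj a * g, qcnj a' * g') \<in> lattice"
proof -
  obtain c0 c1 c2 c3 c0' c1' c2' c3' where g: "g = qcomb p q c0 c1 c2 c3" "g' = qcomb p' q' c0' c1' c2' c3'"
    and c: "(c0, c0') \<in> R" "(c1, c1') \<in> R" "(c2, c2') \<in> R" "(c3, c3') \<in> R"
    using assms unfolding lattice_def by blast
  obtain d0 d1 d2 d3 d0' d1' d2' d3' where
    ag: "a * g = qcomb p q d0 d1 d2 d3" "a' * g' = qcomb p' q' d0' d1' d2' d3'"
    and d: "(d0, d0') \<in> R" "(d1, d1') \<in> R" "(d2, d2') \<in> R" "(d3, d3') \<in> R"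
    using assms unfolding lattice_def by blast
  have "qcnj a * g = qcomb p q (2 * qre a * c0 - d0) (2 * qre a * c1 - d1) (2 * qre a * c2 - d2) (2 * qre a * c3 - d3)"
    unfolding qcnj_altdef left_diff_distrib ag by (simp add: g qcomb_def algebra_simps)
  moreover have "qcnj a' * g' = qcomb p' q' (2 * qre a' * c0' - d0') (2 * qre a' * c1' - d1')
      (2 * qre a' * c2' - d2') (2 * qre a' * c3' - d3')"
    unfolding qcnj_altdef left_diff_distrib ag by (simp add: g qcomb_def algebra_simps)
  moreover have "(2 * qre a * c0 - d0, 2 * qre a' * c0' - d0') \<in> R" "(2 * qre a * c1 - d1, 2 * qre a' * c1' - d1') \<in> R"
    "(2 * qre a * c2 - d2, 2 * qre a' * c2' - d2') \<in> R" "(2 * qre a * c3 - d3, 2 * qre a' * c3' - d3') \<in> R"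
    by (intro R_closed c d assms(3))+
  ultimately show ?thesis unfolding lattice_def by blast
qed

definition units :: "(quat \<times> quat) set" where
  "units = {(g, g') \<in> lattice. qnorm2 g = 1 \<and> qnorm2 g' = 1}"

lemma finite_units: "finite units"
proof -
  obtain K where K: "\<And>c0 c1 c2 c3. qnorm2 (qcomb p q c0 c1 c2 c3) = 1 \<Longrightarrow>
    \<bar>c0\<bar> \<le> K \<and> \<bar>c1\<bar> \<le> K \<and> \<bar>c2\<bar> \<le> K \<and> \<bar>c3\<bar> \<le> K"
    using qcomb_coefficients_bounded[OF pos] by blast
  obtain K' where K': "\<And>c0 c1 c2 c3. qnorm2 (qcomb p' q' c0 c1 c2 c3) = 1 \<Longrightarrow>
    \<bar>c0\<bar> \<le> K' \<and> \<bar>c1\<bar> \<le> K' \<and> \<bar>c2\<bar> \<le> K' \<and> \<bar>c3\<bar> \<le> K'"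
    using qcomb_coefficients_bounded[OF pos'] by blast
  define B where "B = {z \<in> R. \<bar>fst z\<bar> \<le> max K K' \<and> \<bar>snd z\<bar> \<le> max K K'}"
  have "finite B" unfolding B_def by (rule finite_bounded_quadratic_pairs[OF \<gamma>(3)])
  have "units \<subseteq> (\<lambda>(z0, z1, z2, z3). (qcomb p q (fst z0) (fst z1) (fst z2) (fst z3),
      qcomb p' q' (snd z0) (snd z1) (snd z2) (snd z3))) ` (B \<times> B \<times> B \<times> B)"
  proof safe
    fix g g' assume "(g, g') \<in> units"
    then obtain c0 c1 c2 c3 c0' c1' c2' c3' where g: "g = qcomb p q c0 c1 c2 c3" "g' = qcomb p' q' c0' c1' c2' c3'"
      and c: "(c0, c0') \<in> R" "(c1, c1') \<in> R" "(c2, c2') \<in> R" "(c3, c3') \<in> R"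
      and n: "qnorm2 g = 1" "qnorm2 g' = 1"
      unfolding units_def lattice_def by blast
    have "(c0, c0') \<in> B" "(c1, c1') \<in> B" "(c2, c2') \<in> B" "(c3, c3') \<in> B"
      using c K[OF n(1)[unfolded g]] K'[OF n(2)[unfolded g]] unfolding B_def by (simp_all add: le_max_iff_disj)
    then show "(g, g') \<in> (\<lambda>(z0, z1, z2, z3). (qcomb p q (fst z0) (fst z1) (fst z2) (fst z3),
      qcomb p' q' (snd z0) (snd z1) (snd z2) (snd z3))) ` (B \<times> B \<times> B \<times> B)"
      by (intro image_eqI[of _ _ "((c0, c0'), (c1, c1'), (c2, c2'), (c3, c3'))"]) (simp_all add: g)
  qed
  then show ?thesis by (rule finite_subset) (intro finite_imageI finite_cartesian_product \<open>finite B\<close>)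
qed

text \<open>The lattice is closed under multiplication, but it is shorter to use that the elements mapping it into itself are
  closed under multiplication, and that they belong to the lattice because it contains \<open>1\<close>.\<close>

definition stabilizer :: "(quat \<times> quat) set" where
  "stabilizer = {(a, a'). qnorm2 a = 1 \<and> qnorm2 a' = 1 \<and> (\<forall>(g, g')\<in>lattice. (a * g, a' * g') \<in> lattice)}"

lemma generate_subset_stabilizer:
  assumes "M \<in> generate SO3 {rot p, rot q}"
  shows "\<exists>(a, a')\<in>stabilizer. M = rot a"
  using assms
proof (induction rule: generate.induct)
  case one
  have "(1, 1) \<in> stabilizer" by (auto simp: stabilizer_def qnorm2_def)
  then show ?case by (intro bexI[of _ "(1, 1)"]) (simp_all add: rot_1)
next
  case (incl h)
  have "(p, p') \<in> stabilizer" "(q, q') \<in> stabilizer"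
    using lattice_mult unit by (auto simp: stabilizer_def)
  with incl show ?case by auto
next
  case (inv h)
  have "(qcnj p, qcnj p') \<in> stabilizer" "(qcnj q, qcnj q') \<in> stabilizer"
    using lattice_mult lattice_qcnj_mult unit tr by (auto simp: stabilizer_def)
  with inv show ?case using inv_rot unit by fastforce
next
  case (eng h1 h2)
  then obtain a a' b b' where ab: "(a, a') \<in> stabilizer" "(b, b') \<in> stabilizer" "h1 = rot a" "h2 = rot b"
    by auto
  then have "(a * b, a' * b') \<in> stabilizer"
    by (auto simp: stabilizer_def qnorm2_mult mult.assoc)
  with ab show ?case by (intro bexI[of _ "(a * b, a' * b')"]) (simp_all add: rot_mult)
qed

lemma finite_generate: "finite (generate SO3 {rot p, rot q})"
proof -
  have "1 = qcomb p q 1 0 0 0" "1 = qcomb p' q' 1 0 0 0" by (simp_all add: qcomb_def)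
  then have one: "(1, 1) \<in> lattice"
    unfolding lattice_def using quadratic_pairs_0 quadratic_pairs_1 by blast
  have "stabilizer \<subseteq> units"
  proof safe
    fix a a' assume "(a, a') \<in> stabilizer"
    with one show "(a, a') \<in> units" unfolding stabilizer_def units_def by fastforce
  qed
  then have "generate SO3 {rot p, rot q} \<subseteq> (rot \<circ> fst) ` units"
  proof (intro subsetI)
    fix M assume "M \<in> generate SO3 {rot p, rot q}"
    then obtain a a' where "(a, a') \<in> stabilizer" "M = rot a"
      using generate_subset_stabilizer by blast
    with \<open>stabilizer \<subseteq> units\<close> show "M \<in> (rot \<circ> fst) ` units"
      by (intro image_eqI[of _ _ "(a, a')"]) auto
  qed
  then show ?thesis using finite_units by (meson finite_imageI finite_subset)
qed

end

text \<open>The condition on the traces \<open>x\<close>, \<open>y\<close>, \<open>z\<close> of \<open>p\<close>,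
  \<open>q\<close>, \<open>p q\<close> under which they are realised by two unit quaternions with different axes: the Gram
  matrix that they determine is positive definite.\<close>

definition spherical :: "real \<Rightarrow> real \<Rightarrow> real \<Rightarrow> bool" where
  "spherical x y z \<longleftrightarrow> x\<^sup>2 < 4 \<and> y\<^sup>2 < 4 \<and> x\<^sup>2 + y\<^sup>2 + z\<^sup>2 - x * y * z < 4"

lemma spherical_realization:
  assumes "spherical x y z"
  obtains p q where "qnorm2 p = 1" "qnorm2 q = 1" "2 * qre p = x" "2 * qre q = y" "2 * qre (p * q) = z"
    "qi p \<noteq> 0" "qj p = 0" "qk p = 0" "qj q \<noteq> 0" "qk q = 0"
proof -
  define s where "s = sqrt (1 - x\<^sup>2 / 4)"
  define e where "e = (x * y / 4 - z / 2) / s"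
  define r where "r = sqrt (1 - y\<^sup>2 / 4 - e\<^sup>2)"
  have s: "s > 0" "s\<^sup>2 = 1 - x\<^sup>2 / 4" using assms by (simp_all add: s_def spherical_def)
  have "e\<^sup>2 * s\<^sup>2 = (x * y / 4 - z / 2)\<^sup>2" using s(1) by (simp add: e_def power_divide)
  then have "(1 - y\<^sup>2 / 4 - e\<^sup>2) * s\<^sup>2 = (1 - y\<^sup>2 / 4) * (1 - x\<^sup>2 / 4) - (x * y / 4 - z / 2)\<^sup>2"
    unfolding left_diff_distrib s(2) by simp
  also have "\<dots> = (4 - (x\<^sup>2 + y\<^sup>2 + z\<^sup>2 - x * y * z)) / 4"
    by (simp add: power2_eq_square field_simps)
  also have "\<dots> > 0" using assms by (simp add: spherical_def)
  finally have "1 - y\<^sup>2 / 4 - e\<^sup>2 > 0" using s(1) by (simp add: zero_less_mult_iff)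
  then have r: "r > 0" "r\<^sup>2 = 1 - y\<^sup>2 / 4 - e\<^sup>2" by (simp_all add: r_def)
  have "s * e = x * y / 4 - z / 2" using s(1) by (simp add: e_def)
  show ?thesis
    by (rule that[of "Quat (x / 2) s 0 0" "Quat (y / 2) e r 0"])
      (use s r \<open>s * e = _\<close> in \<open>simp_all add: qnorm2_def power_divide\<close>)
qed

text \<open>If the traces of \<open>p\<close>, \<open>q\<close> and \<open>p q\<close> are integers of a real quadratic ring
  and their conjugates are spherical, then the conjugates are realised by unit quaternions too, and the group is a subgroup
  of a discrete group in a product of two compact groups.\<close>

lemma finite_generate_of_spherical_conjugate:
  assumes \<gamma>: "\<gamma>\<^sup>2 = of_int u * \<gamma> + of_int v" "\<gamma>'\<^sup>2 = of_int u * \<gamma>' + of_int v" "\<gamma> \<noteq> \<gamma>'"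
    and p: "qnorm2 p = 1" "qi p \<noteq> 0" "qj p = 0" "qk p = 0"
    and q: "qnorm2 q = 1" "qj q \<noteq> 0" "qk q = 0"
    and tr: "(2 * qre p, x') \<in> quadratic_pairs \<gamma> \<gamma>'" "(2 * qre q, y') \<in> quadratic_pairs \<gamma> \<gamma>'"
      "(2 * qre (p * q), z') \<in> quadratic_pairs \<gamma> \<gamma>'"
    and "spherical x' y' z'"
  shows "finite (generate SO3 {rot p, rot q})"
proof -
  obtain p' q' where "qnorm2 p' = 1" "qnorm2 q' = 1" "2 * qre p' = x'" "2 * qre q' = y'" "2 * qre (p' * q') = z'"
    "qi p' \<noteq> 0" "qj p' = 0" "qk p' = 0" "qj q' \<noteq> 0" "qk q' = 0"
    using spherical_realization[OF \<open>spherical x' y' z'\<close>] by blast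
  then interpret conjugate_pair \<gamma> \<gamma>' u v p q p' q'
    using assms by unfold_locales (simp_all del: quat_mult_sel)
  show ?thesis by (rule finite_generate)
qed


section \<open>The dihedral case\<close>

text \<open>For \<open>\<phi> = \<pi>/2\<close> the second axis is the negative of the second coordinate axis.\<close>

definition yquat :: "real \<Rightarrow> quat" where
  "yquat t = Quat (cos t) 0 (- sin t) 0"

lemma qnorm2_yquat: "qnorm2 (yquat t) = 1"
  by (simp add: qnorm2_def yquat_def)

lemma yquat_mult: "yquat s * yquat t = yquat (s + t)"
  by (rule quat_eqI) (simp_all add: yquat_def cos_add sin_add)

lemma yquat_times_i: "yquat s * xquat (pi / 2) = xquat (pi / 2) * yquat (- s)"
  by (rule quat_eqI) (simp_all add: yquat_def xquat_def)

text \<open>The half turn about the first axis inverts the rotations about the second one. So every element is a power of the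
  rotation \<open>y\<close>, possibly multiplied by the half turn \<open>x\<close>, and \<open>y\<close> has order \<open>4
  n\<close> as a quaternion.\<close>

lemma finite_generate_dihedral:
  assumes "n > 0"
  shows "finite (generate SO3 {rot (xquat (pi / 2)), rot (xyquat (pi / 2) (pi / (2 * real n)))})"
proof -
  define \<beta> where "\<beta> = pi / (2 * real n)"
  define x where "x = xquat (pi / 2)"
  define y where "y k = yquat (real_of_int k * \<beta>)" for k
  have q: "xyquat (pi / 2) \<beta> = y 1"
    by (simp add: xyquat_def y_def yquat_def)
  have yy: "y k * y l = y (k + l)" for k l by (simp add: y_def yquat_mult algebra_simps)
  have y0: "y 0 = 1" by (simp add: y_def yquat_def quat_eq_iff)
  have yx: "y k * x = x * y (- k)" for k by (simp add: y_def x_def yquat_times_i)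
  have xx: "x * x = - 1" by (simp add: x_def xquat_def quat_eq_iff)
  have yx': "y k * (x * g) = x * (y (- k) * g)" for k g by (simp add: yx flip: mult.assoc)
  have yy': "y k * (y l * g) = y (k + l) * g" for k l g by (simp add: yy flip: mult.assoc)
  have xx': "x * (x * g) = - g" for g by (simp add: xx flip: mult.assoc)
  have nx: "qnorm2 x = 1" "qnorm2 (y k) = 1" for k
    by (simp_all add: x_def y_def qnorm2_xquat qnorm2_yquat)
  have cx: "qcnj x = - x" by (simp add: x_def xquat_def quat_eq_iff)
  have cy: "qcnj (y k) = y (- k)" for k by (simp add: y_def yquat_def quat_eq_iff)
  have step: "\<exists>k. M = rot (y k) \<or> M = rot (x * y k)" if "M \<in> generate SO3 {rot x, rot (y 1)}" for M
    using that
  proof (induction rule: generate.induct)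
    case one
    then show ?case by (intro exI[of _ 0]) (simp add: y0 rot_1)
  next
    case (incl h)
    then consider "h = rot x" | "h = rot (y 1)" by auto
    then show ?case
    proof cases
      case 1
      then show ?thesis by (intro exI[of _ 0]) (simp add: y0)
    qed auto
  next
    case (inv h)
    then consider "h = rot x" | "h = rot (y 1)" by auto
    then show ?case
    proof cases
      case 1
      then have "inv\<^bsub>SO3\<^esub> h = rot (x * y 0)" by (simp add: inv_rot nx cx y0)
      then show ?thesis by blast
    next
      case 2
      then have "inv\<^bsub>SO3\<^esub> h = rot (y (- 1))" by (simp add: inv_rot nx cy)
      then show ?thesis by blast
    qed
  next
    case (eng h1 h2)
    obtain k where "h1 = rot (y k) \<or> h1 = rot (x * y k)" using eng.IH(1) by blast
    moreover obtain l where "h2 = rot (y l) \<or> h2 = rot (x * y l)" using eng.IH(2) by blast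
    ultimately have "h1 \<otimes>\<^bsub>SO3\<^esub> h2 \<in> {rot (y k * y l), rot (y k * (x * y l)), rot (x * y k * y l), rot (x * y k * (x * y l))}"
      by (auto simp: rot_mult[symmetric])
    also have "\<dots> = {rot (y (k + l)), rot (x * y (l - k)), rot (x * y (k + l)), rot (y (l - k))}"
      by (simp add: mult.assoc yx' yy yy' xx' add.commute)
    finally show ?case by blast
  qed
  have per: "y k = y (k mod (4 * int n))" for k
  proof -
    define j where "j = k div (4 * int n)"
    have "k = k mod (4 * int n) + j * (4 * int n)" unfolding j_def by (rule mod_div_mult_eq[symmetric])
    from arg_cong[OF this, of real_of_int]
    have "real_of_int k = real_of_int (k mod (4 * int n)) + real_of_int j * (4 * real n)"
      unfolding of_int_add of_int_mult of_int_numeral of_int_of_nat_eq .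
    then have "real_of_int k * \<beta> = real_of_int (k mod (4 * int n)) * \<beta> + real_of_int j * (4 * real n * \<beta>)"
      by (simp add: algebra_simps)
    also have "4 * real n * \<beta> = 2 * pi" using assms by (simp add: \<beta>_def)
    finally have e: "real_of_int k * \<beta> = real_of_int (k mod (4 * int n)) * \<beta> + 2 * pi * real_of_int j"
      by simp
    have "cos (s + 2 * pi * real_of_int j) = cos s" "sin (s + 2 * pi * real_of_int j) = sin s" for s
      by (simp_all add: cos_add sin_add)
    then show ?thesis unfolding y_def yquat_def e by simp
  qed
  have y_img: "y k \<in> y ` {0..<4 * int n}" for k
    using assms by (subst per) simp
  have "generate SO3 {rot x, rot (y 1)} \<subseteq> rot ` y ` {0..<4 * int n} \<union> (\<lambda>g. rot (x * g)) ` y ` {0..<4 * int n}"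
  proof
    fix M assume "M \<in> generate SO3 {rot x, rot (y 1)}"
    then obtain k where "M = rot (y k) \<or> M = rot (x * y k)" using step by blast
    then show "M \<in> rot ` y ` {0..<4 * int n} \<union> (\<lambda>g. rot (x * g)) ` y ` {0..<4 * int n}"
      using imageI[OF y_img[of k], of rot] imageI[OF y_img[of k], of "\<lambda>g. rot (x * g)"]
      by (elim disjE) simp_all
  qed
  then show ?thesis unfolding \<beta>_def[symmetric] q x_def[symmetric] by (rule finite_subset) simp
qed

section \<open>The golden ratio and the cosines of the listed angles\<close>

text \<open>All numbers of \<open>\<rat>(\<surd>5)\<close> are written in terms of the golden ratio. This rule and the next
  reduce every polynomial in it to a linear one.\<close>

lemma golden_square: "golden * golden = golden + 1"
  by (simp add: golden_def field_simps)

lemma golden_mult: "golden * (golden * t) = golden * t + t"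
  by (simp add: golden_square distrib_right flip: mult.assoc)

lemma sqrt5_eq_golden: "sqrt 5 = 2 * golden - 1"
  by (simp add: golden_def add_divide_distrib)

lemma golden_bounds: "3 / 2 < golden" "golden < 5 / 3"
proof -
  have "2 < sqrt 5" by (rule real_less_rsqrt) simp
  then show "3 / 2 < golden" by (simp add: golden_def)
  have "sqrt 5 < 7 / 3" by (rule real_less_lsqrt) (simp_all add: power2_eq_square)
  then show "golden < 5 / 3" by (simp add: golden_def)
qed

lemma inverse_golden: "inverse golden = golden - 1"
proof -
  have "golden * (golden - 1) = 1" by (simp add: golden_square algebra_simps)
  then show ?thesis using inverse_unique by blast
qed

lemma inverse_sqrt5: "1 / sqrt 5 = (2 * golden - 1) / 5"
  unfolding sqrt5_eq_golden[symmetric] by (simp add: field_simps)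

text \<open>With \<open>x = cos (2\<pi>/5)\<close>, the equality of \<open>cos (3 \<cdot> 2\<pi>/5)\<close> and \<open>cos (2
  \<cdot> 2\<pi>/5)\<close> is a cubic equation for \<open>x\<close> whose other roots are \<open>1\<close> and a negative
  number.\<close>

lemma cos_2pi_5: "cos (2 * pi / 5) = (golden - 1) / 2"
proof -
  define x where "x = cos (2 * pi / 5)"
  have "cos (3 * (2 * pi / 5)) = cos (2 * pi - 2 * (2 * pi / 5))" by (rule arg_cong[of _ _ cos]) simp
  also have "\<dots> = cos (2 * (2 * pi / 5))" by (simp only: cos_2pi_minus)
  finally have "4 * x ^ 3 - 3 * x = 2 * x\<^sup>2 - 1"
    unfolding cos_treble_cos cos_double_cos x_def .
  moreover have "(x - 1) * ((2 * x - (golden - 1)) * (2 * x + golden)) = 4 * x ^ 3 - 3 * x - (2 * x\<^sup>2 - 1)"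
    by (simp add: algebra_simps power2_eq_square power3_eq_cube golden_square golden_mult)
  ultimately have "(x - 1) * ((2 * x - (golden - 1)) * (2 * x + golden)) = 0" by simp
  moreover have "cos (2 * pi / 5) < cos 0" by (rule cos_monotone_0_pi) simp_all
  then have "x \<noteq> 1" by (simp add: x_def)
  moreover have "x > 0" unfolding x_def by (rule cos_gt_zero) simp_all
  then have "2 * x + golden \<noteq> 0" using golden_bounds by simp
  ultimately show ?thesis by (simp add: x_def)
qed

lemma cos_4pi_5: "cos (4 * pi / 5) = - (golden / 2)"
proof -
  have "cos (4 * pi / 5) = 2 * ((golden - 1) / 2)\<^sup>2 - 1"
    using cos_double_cos[of "2 * pi / 5"] unfolding cos_2pi_5 by simp
  then show ?thesis by (simp add: power2_eq_square golden_square algebra_simps)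
qed

lemma cos_pi_5: "cos (pi / 5) = golden / 2"
proof -
  have "pi - pi / 5 = 4 * pi / 5" by simp
  then show ?thesis using cos_pi_minus[of "pi / 5"] cos_4pi_5 by simp
qed

lemma cos_3pi_5: "cos (3 * pi / 5) = (1 - golden) / 2"
proof -
  have "pi - 2 * pi / 5 = 3 * pi / 5" by simp
  then show ?thesis using cos_pi_minus[of "2 * pi / 5"] cos_2pi_5 by (simp add: diff_divide_distrib)
qed

lemma cos_3pi_4: "cos (3 * pi / 4) = - (sqrt 2 / 2)"
proof -
  have "pi - pi / 4 = 3 * pi / 4" by simp
  then show ?thesis using cos_pi_minus[of "pi / 4"] cos_45 by simp
qed

lemmas cos_table = cos_pi cos_pi_half cos_60 cos_120 cos_45 cos_3pi_4
  cos_pi_5 cos_2pi_5 cos_3pi_5 cos_4pi_5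

lemma algebraic_int_golden: "algebraic_int golden"
  by (rule algebraic_int.intros[of "[:- 1, - 1, 1:]"])
    (auto simp: golden_square algebra_simps coeff_pCons split: nat.splits)

lemma algebraic_int_quadratic:
  assumes "algebraic_int \<gamma>"
  shows "algebraic_int (of_int m + of_int n * \<gamma> :: real)"
  by (intro algebraic_int_add_real algebraic_int_mult_real assms algebraic_int_of_int)


section \<open>The dichotomy between non-integral and spherical pairs\<close>

text \<open>The alternative for rotation angles \<open>a\<close>, \<open>b\<close> and axes with cosine \<open>c\<close>:
  either the Gram determinant is not integral, or the traces of the lifts lie in a real quadratic ring with spherical
  conjugates. For rational multiples of \<open>\<pi>\<close> the first excludes that the product of the rotations has finite
  order; the second makes the group finite.\<close>

definition dichotomy :: "real \<Rightarrow> real \<Rightarrow> real \<Rightarrow> bool" where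
  "dichotomy a b c \<longleftrightarrow>
     \<not> algebraic_int ((1 - cos a) * (1 - cos b) * (1 - c\<^sup>2)) \<or>
     (\<exists>\<gamma> \<gamma>' u v x' y' z'.
        \<gamma>\<^sup>2 = of_int u * \<gamma> + of_int v \<and> \<gamma>'\<^sup>2 = of_int u * \<gamma>' + of_int v \<and> \<gamma> \<noteq> \<gamma>' \<and>
        (2 * cos (a / 2), x') \<in> quadratic_pairs \<gamma> \<gamma>' \<and>
        (2 * cos (b / 2), y') \<in> quadratic_pairs \<gamma> \<gamma>' \<and>
        (2 * (cos (a / 2) * cos (b / 2) - sin (a / 2) * sin (b / 2) * c), z') \<in> quadratic_pairs \<gamma> \<gamma>' \<and>
        spherical x' y' z')"

lemma spherical_commute: "spherical x y z \<longleftrightarrow> spherical y x z"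
  by (auto simp: spherical_def add_ac mult_ac)

lemma dichotomy_commute:
  assumes "dichotomy a b c"
  shows "dichotomy b a c"
  using assms unfolding dichotomy_def
proof (elim disjE exE conjE)
  assume "\<not> algebraic_int ((1 - cos a) * (1 - cos b) * (1 - c\<^sup>2))"
  then show "\<not> algebraic_int ((1 - cos b) * (1 - cos a) * (1 - c\<^sup>2)) \<or> P" for P
    by (simp only: mult.commute[of "1 - cos a"]) simp
next
  fix \<gamma> \<gamma>' u v x' y' z'
  assume \<gamma>: "\<gamma>\<^sup>2 = of_int u * \<gamma> + of_int v" "\<gamma>'\<^sup>2 = of_int u * \<gamma>' + of_int v" "\<gamma> \<noteq> \<gamma>'"
    and xy: "(2 * cos (a / 2), x') \<in> quadratic_pairs \<gamma> \<gamma>'" "(2 * cos (b / 2), y') \<in> quadratic_pairs \<gamma> \<gamma>'"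
    and z: "(2 * (cos (a / 2) * cos (b / 2) - sin (a / 2) * sin (b / 2) * c), z') \<in> quadratic_pairs \<gamma> \<gamma>'"
    and s: "spherical x' y' z'"
  have "(2 * (cos (b / 2) * cos (a / 2) - sin (b / 2) * sin (a / 2) * c), z') \<in> quadratic_pairs \<gamma> \<gamma>'"
    using z by (simp only: mult.commute[of "cos (b / 2)"] mult.commute[of "sin (b / 2)"])
  moreover have "spherical y' x' z'" using s by (simp only: spherical_commute[of x'])
  ultimately show "Q \<or> (\<exists>\<gamma> \<gamma>' u v x' y' z'.
        \<gamma>\<^sup>2 = of_int u * \<gamma> + of_int v \<and> \<gamma>'\<^sup>2 = of_int u * \<gamma>' + of_int v \<and> \<gamma> \<noteq> \<gamma>' \<and>
        (2 * cos (b / 2), x') \<in> quadratic_pairs \<gamma> \<gamma>' \<and>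
        (2 * cos (a / 2), y') \<in> quadratic_pairs \<gamma> \<gamma>' \<and>
        (2 * (cos (b / 2) * cos (a / 2) - sin (b / 2) * sin (a / 2) * c), z') \<in> quadratic_pairs \<gamma> \<gamma>' \<and>
        spherical x' y' z')" for Q
    using \<gamma> xy by blast
qed

lemma fraction_not_algebraic_int:
  assumes "x = real m / real n" "\<not> n dvd m" "n > 0"
  shows "\<not> algebraic_int x"
proof
  assume "algebraic_int x"
  then have "x \<in> \<int>" using assms(1) by (intro rational_algebraic_int_is_int) simp_all
  then obtain k where "x = of_int k" by (rule Ints_cases)
  with assms(1,3) have "real_of_int (int m) = real_of_int (k * int n)"
    by (simp add: field_simps)
  then have "int m = k * int n" by (simp only: of_int_eq_iff)
  then have "int n dvd int m" by simp
  then show False using assms(2) by simp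
qed

lemma not_algebraic_int_by_multiplier:
  assumes "algebraic_int e" "D\<^sup>2 * e = real m / real n" "\<not> n dvd m" "n > 0"
  shows "\<not> algebraic_int D"
  using fraction_not_algebraic_int[OF assms(2-4)] algebraic_int_mult_real[OF algebraic_int_power_real assms(1)]
  by blast

text \<open>The non-integral values that the Gram determinant takes for the halved triplets. Each of them has a square that
  becomes a rational number with denominator \<open>9\<close>, \<open>5\<close>, \<open>4\<close> or \<open>2\<close> after
  multiplication by a unit of \<open>\<int>[\<rho>]\<close> or \<open>\<int>[\<surd>2]\<close>; the units are
  \<open>1\<close>, the even powers of \<open>\<rho>\<close> with exponents from \<open>-6\<close> to \<open>6\<close>, and
  \<open>3 \<plusminus> 2 \<surd>2\<close>.\<close>

definition nonintegral_values :: "real set" where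
  "nonintegral_values = {1 / 3, 2 / 3, 1 / 2,
    (7 - 4 * golden) / 5, (3 + 4 * golden) / 5, (3 - golden) / 5, (2 + golden) / 5,
    (2 - golden) / 3, (1 + golden) / 3, (2 - golden) / 2, (1 + golden) / 2,
    (2 - sqrt 2) / 2, (2 + sqrt 2) / 2}"

lemma nonintegral_table:
  assumes "D \<in> nonintegral_values"
  shows "\<not> algebraic_int D"
proof -
  have g: "algebraic_int (of_int m + of_int n * golden)" for m n
    by (rule algebraic_int_quadratic[OF algebraic_int_golden])
  have r: "algebraic_int (of_int m + of_int n * sqrt 2)" for m n
    by (rule algebraic_int_quadratic) (rule algebraic_int_sqrt, simp)
  \<comment> \<open>In the applications below \<open>k + l \<rho>\<close> and \<open>k + l \<surd>2\<close> are these units, and \<open>m / n\<close> is the resulting fraction.\<close>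
  have g_case: "\<not> algebraic_int D"
    if "D\<^sup>2 * (of_int k + of_int l * golden) = real m / real n" "\<not> n dvd m" "n > 0" for D k l m n
    using that by (rule not_algebraic_int_by_multiplier[OF g])
  have r_case: "\<not> algebraic_int D"
    if "D\<^sup>2 * (of_int k + of_int l * sqrt 2) = real m / real n" "\<not> n dvd m" "n > 0" for D k l m n
    using that by (rule not_algebraic_int_by_multiplier[OF r])
  note norm = power2_eq_square field_simps golden_square golden_mult
  have n1: "\<not> algebraic_int (1 / 3 :: real)"
    by (rule g_case[of _ 1 0 1 9]) (simp_all add: norm)
  have n2: "\<not> algebraic_int (2 / 3 :: real)"
    by (rule g_case[of _ 1 0 4 9]) (simp_all add: norm)
  have n3: "\<not> algebraic_int (1 / 2 :: real)"
    by (rule g_case[of _ 1 0 1 4]) (simp_all add: norm)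
  have n4: "\<not> algebraic_int ((7 - 4 * golden) / 5 :: real)"
    by (rule g_case[of _ 5 8 1 5]) (simp_all add: norm)
  have n5: "\<not> algebraic_int ((3 + 4 * golden) / 5 :: real)"
    by (rule g_case[of _ 13 "- 8" 1 5]) (simp_all add: norm)
  have n6: "\<not> algebraic_int ((3 - golden) / 5 :: real)"
    by (rule g_case[of _ 1 1 1 5]) (simp_all add: norm)
  have n7: "\<not> algebraic_int ((2 + golden) / 5 :: real)"
    by (rule g_case[of _ 2 "- 1" 1 5]) (simp_all add: norm)
  have n8: "\<not> algebraic_int ((2 - golden) / 3 :: real)"
    by (rule g_case[of _ 2 3 1 9]) (simp_all add: norm)
  have n9: "\<not> algebraic_int ((1 + golden) / 3 :: real)"
    by (rule g_case[of _ 5 "- 3" 1 9]) (simp_all add: norm)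
  have n10: "\<not> algebraic_int ((2 - golden) / 2 :: real)"
    by (rule g_case[of _ 2 3 1 4]) (simp_all add: norm)
  have n11: "\<not> algebraic_int ((1 + golden) / 2 :: real)"
    by (rule g_case[of _ 5 "- 3" 1 4]) (simp_all add: norm)
  have n12: "\<not> algebraic_int ((2 - sqrt 2) / 2 :: real)"
    by (rule r_case[of _ 3 2 1 2]) (simp_all add: norm)
  have n13: "\<not> algebraic_int ((2 + sqrt 2) / 2 :: real)"
    by (rule r_case[of _ 3 "- 2" 1 2]) (simp_all add: norm)
  from assms show ?thesis unfolding nonintegral_values_def
    by (elim insertE emptyE) (use n1 n2 n3 n4 n5 n6 n7 n8 n9 n10 n11 n12 n13 in blast)+
qed

lemma dichotomy_nonintegral:
  assumes "c\<^sup>2 = q" "(1 - cos a) * (1 - cos b) * (1 - q) \<in> nonintegral_values"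
  shows "dichotomy a b c"
  using nonintegral_table[OF assms(2)] unfolding dichotomy_def assms(1) by blast

text \<open>The number \<open>t\<close> is the term of \<open>z\<close> that contains the product of the sines and the cosine
  of \<open>\<phi>\<close>. It is not negative, so it can be given through its square, which involves only the cosines of the
  full angles.\<close>

lemma dichotomy_spherical:
  assumes \<gamma>: "\<gamma>\<^sup>2 = of_int u * \<gamma> + of_int v" "\<gamma>'\<^sup>2 = of_int u * \<gamma>' + of_int v" "\<gamma> \<noteq> \<gamma>'"
    and ab: "0 \<le> a" "a \<le> pi" "0 \<le> b" "b \<le> pi" and c: "0 \<le> c"
    and x: "2 * cos (a / 2) = of_int k1 + of_int l1 * \<gamma>"
    and y: "2 * cos (b / 2) = of_int k2 + of_int l2 * \<gamma>"
    and t: "0 \<le> t" "(1 - cos a) * (1 - cos b) * c\<^sup>2 = t\<^sup>2"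
    and z: "2 * cos (a / 2) * (2 * cos (b / 2)) / 2 - t = of_int k3 + of_int l3 * \<gamma>"
    and s: "spherical (of_int k1 + of_int l1 * \<gamma>') (of_int k2 + of_int l2 * \<gamma>') (of_int k3 + of_int l3 * \<gamma>')"
  shows "dichotomy a b c"
proof -
  have "(2 * (sin (a / 2) * sin (b / 2) * c))\<^sup>2 = (2 * (sin (a / 2))\<^sup>2) * (2 * (sin (b / 2))\<^sup>2) * c\<^sup>2"
    by (simp add: power_mult_distrib)
  also have "\<dots> = t\<^sup>2" unfolding sin_half_squared by (rule t(2))
  finally have "2 * (sin (a / 2) * sin (b / 2) * c) = t"
    by (rule power2_eq_imp_eq) (use ab c t in \<open>auto intro!: mult_nonneg_nonneg sin_ge_zero\<close>)
  then have "2 * (cos (a / 2) * cos (b / 2) - sin (a / 2) * sin (b / 2) * c)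
      = 2 * cos (a / 2) * (2 * cos (b / 2)) / 2 - t"
    by simp
  then have "2 * (cos (a / 2) * cos (b / 2) - sin (a / 2) * sin (b / 2) * c) = of_int k3 + of_int l3 * \<gamma>"
    unfolding z .
  note pairs = quadratic_pairsI[OF x refl] quadratic_pairsI[OF y refl] quadratic_pairsI[OF this refl]
  show ?thesis unfolding dichotomy_def
    by (intro disjI2 exI conjI) (rule \<gamma> pairs s)+
qed

lemma half_angle_table:
  "2 * cos (pi / 2) = 0" "2 * cos (2 * pi / 3 / 2) = 1" "2 * cos (pi / 2 / 2) = sqrt 2"
  "2 * cos (2 * pi / 5 / 2) = golden" "2 * cos (4 * pi / 5 / 2) = golden - 1"
proof -
  have "2 * pi / 3 / 2 = pi / 3" "2 * pi / 5 / 2 = pi / 5" "4 * pi / 5 / 2 = 2 * pi / 5" by simp_all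
  then show "2 * cos (pi / 2) = 0" "2 * cos (2 * pi / 3 / 2) = 1" "2 * cos (pi / 2 / 2) = sqrt 2"
    "2 * cos (2 * pi / 5 / 2) = golden" "2 * cos (4 * pi / 5 / 2) = golden - 1"
    by (simp_all only: cos_table cos_45 cos_60) (simp_all add: cos_45)
qed

lemma dichotomy_sqrt2:
  assumes "0 \<le> a" "a \<le> pi" "0 \<le> b" "b \<le> pi" "0 \<le> c"
    and "2 * cos (a / 2) = of_int k1 + of_int l1 * sqrt 2"
    and "2 * cos (b / 2) = of_int k2 + of_int l2 * sqrt 2"
    and "0 \<le> t" "(1 - cos a) * (1 - cos b) * c\<^sup>2 = t\<^sup>2"
    and "2 * cos (a / 2) * (2 * cos (b / 2)) / 2 - t = of_int k3 + of_int l3 * sqrt 2"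
    and "spherical (of_int k1 - of_int l1 * sqrt 2) (of_int k2 - of_int l2 * sqrt 2) (of_int k3 - of_int l3 * sqrt 2)"
  shows "dichotomy a b c"
  by (rule dichotomy_spherical[where u = 0 and v = 2 and \<gamma> = "sqrt 2" and \<gamma>' = "- sqrt 2"
        and ?k1.0 = k1 and ?l1.0 = l1 and ?k2.0 = k2 and ?l2.0 = l2 and ?k3.0 = k3 and ?l3.0 = l3 and t = t])
    (use assms in simp_all)

lemma dichotomy_golden:
  assumes "0 \<le> a" "a \<le> pi" "0 \<le> b" "b \<le> pi" "0 \<le> c"
    and "2 * cos (a / 2) = of_int k1 + of_int l1 * golden"
    and "2 * cos (b / 2) = of_int k2 + of_int l2 * golden"
    and "0 \<le> t" "(1 - cos a) * (1 - cos b) * c\<^sup>2 = t\<^sup>2"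
    and "2 * cos (a / 2) * (2 * cos (b / 2)) / 2 - t = of_int k3 + of_int l3 * golden"
    and "spherical (of_int k1 + of_int l1 * (1 - golden)) (of_int k2 + of_int l2 * (1 - golden))
      (of_int k3 + of_int l3 * (1 - golden))"
  shows "dichotomy a b c"
  by (rule dichotomy_spherical[where u = 1 and v = 1 and \<gamma> = golden and \<gamma>' = "1 - golden"
        and ?k1.0 = k1 and ?l1.0 = l1 and ?k2.0 = k2 and ?l2.0 = l2 and ?k3.0 = k3 and ?l3.0 = l3 and t = t])
    (use assms golden_bounds in \<open>simp_all add: power2_eq_square algebra_simps golden_square\<close>)

text \<open>All pairs of halved and unhalved angles that occur, with the squared cosine of the angle of the axes, are listed
  here and in the next lemma, up to interchanging the angles. Here are those with non-integral Gram determinant.\<close>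

lemma nonintegral_rows:
  "c\<^sup>2 = 1 / 9 \<Longrightarrow> dichotomy (pi / 3) (2 * pi / 3) c"
  "c\<^sup>2 = 1 / 3 \<Longrightarrow> dichotomy pi (pi / 3) c"
  "c\<^sup>2 = 2 / 3 \<Longrightarrow> dichotomy pi (pi / 3) c"
  "c\<^sup>2 = 2 / 3 \<Longrightarrow> dichotomy (pi / 2) (2 * pi / 3) c"
  "c\<^sup>2 = 1 / 2 \<Longrightarrow> dichotomy pi (pi / 4) c"
  "c\<^sup>2 = 1 / 2 \<Longrightarrow> dichotomy pi (3 * pi / 4) c"
  "c\<^sup>2 = 1 / 2 \<Longrightarrow> dichotomy (pi / 2) (pi / 2) c"
  "c\<^sup>2 = 1 / 3 \<Longrightarrow> dichotomy (pi / 3) (pi / 2) c"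
  "c\<^sup>2 = 1 / 3 \<Longrightarrow> dichotomy (2 * pi / 3) (pi / 4) c"
  "c\<^sup>2 = 1 / 3 \<Longrightarrow> dichotomy (2 * pi / 3) (3 * pi / 4) c"
  "c\<^sup>2 = 0 \<Longrightarrow> dichotomy (pi / 2) (pi / 4) c"
  "c\<^sup>2 = 0 \<Longrightarrow> dichotomy (pi / 2) (3 * pi / 4) c"
  "c\<^sup>2 = (golden + 1) / 3 \<Longrightarrow> dichotomy pi (pi / 3) c"
  "c\<^sup>2 = (golden + 1) / 3 \<Longrightarrow> dichotomy (pi / 2) (2 * pi / 3) c"
  "c\<^sup>2 = (golden + 2) / 5 \<Longrightarrow> dichotomy pi (pi / 5) c"
  "c\<^sup>2 = (golden + 2) / 5 \<Longrightarrow> dichotomy pi (3 * pi / 5) c"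
  "c\<^sup>2 = (golden + 2) / 5 \<Longrightarrow> dichotomy (pi / 2) (2 * pi / 5) c"
  "c\<^sup>2 = (golden + 2) / 5 \<Longrightarrow> dichotomy (pi / 2) (4 * pi / 5) c"
  "c\<^sup>2 = (3 - golden) / 5 \<Longrightarrow> dichotomy pi (pi / 5) c"
  "c\<^sup>2 = (3 - golden) / 5 \<Longrightarrow> dichotomy pi (3 * pi / 5) c"
  "c\<^sup>2 = (3 - golden) / 5 \<Longrightarrow> dichotomy (pi / 2) (2 * pi / 5) c"
  "c\<^sup>2 = (3 - golden) / 5 \<Longrightarrow> dichotomy (pi / 2) (4 * pi / 5) c"
  "c\<^sup>2 = 5 / 9 \<Longrightarrow> dichotomy (pi / 3) (2 * pi / 3) c"
  "c\<^sup>2 = (4 * golden + 3) / 15 \<Longrightarrow> dichotomy (2 * pi / 3) (pi / 5) c"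
  "c\<^sup>2 = (4 * golden + 3) / 15 \<Longrightarrow> dichotomy (2 * pi / 3) (3 * pi / 5) c"
  "c\<^sup>2 = (4 * golden + 3) / 15 \<Longrightarrow> dichotomy (pi / 3) (2 * pi / 5) c"
  "c\<^sup>2 = (4 * golden + 3) / 15 \<Longrightarrow> dichotomy (pi / 3) (4 * pi / 5) c"
  "c\<^sup>2 = (7 - 4 * golden) / 15 \<Longrightarrow> dichotomy (2 * pi / 3) (pi / 5) c"
  "c\<^sup>2 = (7 - 4 * golden) / 15 \<Longrightarrow> dichotomy (2 * pi / 3) (3 * pi / 5) c"
  "c\<^sup>2 = (7 - 4 * golden) / 15 \<Longrightarrow> dichotomy (pi / 3) (2 * pi / 5) c"
  "c\<^sup>2 = (7 - 4 * golden) / 15 \<Longrightarrow> dichotomy (pi / 3) (4 * pi / 5) c"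
  "c\<^sup>2 = 1 / 5 \<Longrightarrow> dichotomy (pi / 5) (2 * pi / 5) c"
  "c\<^sup>2 = 1 / 5 \<Longrightarrow> dichotomy (pi / 5) (4 * pi / 5) c"
  "c\<^sup>2 = 1 / 5 \<Longrightarrow> dichotomy (3 * pi / 5) (2 * pi / 5) c"
  "c\<^sup>2 = 1 / 5 \<Longrightarrow> dichotomy (3 * pi / 5) (4 * pi / 5) c"
  by (erule dichotomy_nonintegral; unfold cos_table;
      simp add: nonintegral_values_def field_simps golden_square golden_mult)+

text \<open>The pairs that generate the rotation groups of the tetrahedron, the octahedron and the icosahedron. All traces
  are explicit, and \<open>t\<close> is found as the nonnegative square root of \<open>(1 - cos a) (1 - cos b)
  c\<^sup>2\<close>.\<close>

lemma spherical_rows: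
  "c\<^sup>2 = 1 / 9 \<Longrightarrow> 0 \<le> c \<Longrightarrow> dichotomy (2 * pi / 3) (2 * pi / 3) c"
  "c\<^sup>2 = 1 / 3 \<Longrightarrow> 0 \<le> c \<Longrightarrow> dichotomy pi (2 * pi / 3) c"
  "c\<^sup>2 = 1 / 3 \<Longrightarrow> 0 \<le> c \<Longrightarrow> dichotomy (pi / 2) (2 * pi / 3) c"
  "c\<^sup>2 = 2 / 3 \<Longrightarrow> 0 \<le> c \<Longrightarrow> dichotomy pi (2 * pi / 3) c"
  "c\<^sup>2 = 1 / 5 \<Longrightarrow> 0 \<le> c \<Longrightarrow> dichotomy (2 * pi / 5) (2 * pi / 5) c"
  "c\<^sup>2 = 1 / 5 \<Longrightarrow> 0 \<le> c \<Longrightarrow> dichotomy (2 * pi / 5) (4 * pi / 5) c"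
  "c\<^sup>2 = 1 / 5 \<Longrightarrow> 0 \<le> c \<Longrightarrow> dichotomy (4 * pi / 5) (4 * pi / 5) c"
  "c\<^sup>2 = (golden + 1) / 3 \<Longrightarrow> 0 \<le> c \<Longrightarrow> dichotomy pi (2 * pi / 3) c"
  "c\<^sup>2 = (golden + 2) / 5 \<Longrightarrow> 0 \<le> c \<Longrightarrow> dichotomy pi (2 * pi / 5) c"
  "c\<^sup>2 = (3 - golden) / 5 \<Longrightarrow> 0 \<le> c \<Longrightarrow> dichotomy pi (2 * pi / 5) c"
  "c\<^sup>2 = (golden + 2) / 5 \<Longrightarrow> 0 \<le> c \<Longrightarrow> dichotomy pi (4 * pi / 5) c"
  "c\<^sup>2 = (3 - golden) / 5 \<Longrightarrow> 0 \<le> c \<Longrightarrow> dichotomy pi (4 * pi / 5) c"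
  "c\<^sup>2 = 5 / 9 \<Longrightarrow> 0 \<le> c \<Longrightarrow> dichotomy (2 * pi / 3) (2 * pi / 3) c"
  "c\<^sup>2 = (4 * golden + 3) / 15 \<Longrightarrow> 0 \<le> c \<Longrightarrow> dichotomy (2 * pi / 3) (2 * pi / 5) c"
  "c\<^sup>2 = (7 - 4 * golden) / 15 \<Longrightarrow> 0 \<le> c \<Longrightarrow> dichotomy (2 * pi / 3) (2 * pi / 5) c"
  "c\<^sup>2 = (4 * golden + 3) / 15 \<Longrightarrow> 0 \<le> c \<Longrightarrow> dichotomy (2 * pi / 3) (4 * pi / 5) c"
  "c\<^sup>2 = (7 - 4 * golden) / 15 \<Longrightarrow> 0 \<le> c \<Longrightarrow> dichotomy (2 * pi / 3) (4 * pi / 5) c"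
proof -
  note norm = spherical_def power2_eq_square field_simps golden_square golden_mult
  assume c: "0 \<le> c"
  show "dichotomy (2 * pi / 3) (2 * pi / 3) c" if "c\<^sup>2 = 1 / 9"
    by (rule dichotomy_golden[where t = "1 / 2" and
          ?k1.0 = 1 and ?l1.0 = 0 and ?k2.0 = 1 and ?l2.0 = 0 and ?k3.0 = 0 and ?l3.0 = 0];
        (unfold half_angle_table cos_table that)?; use c golden_bounds in \<open>simp add: norm\<close>)
  show "dichotomy (pi) (2 * pi / 3) c" if "c\<^sup>2 = 1 / 3"
    by (rule dichotomy_golden[where t = "1" and
          ?k1.0 = 0 and ?l1.0 = 0 and ?k2.0 = 1 and ?l2.0 = 0 and ?k3.0 = "- 1" and ?l3.0 = 0];
        (unfold half_angle_table cos_table that)?; use c golden_bounds in \<open>simp add: norm\<close>)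
  show "dichotomy (pi / 2) (2 * pi / 3) c" if "c\<^sup>2 = 1 / 3"
    by (rule dichotomy_sqrt2[where t = "sqrt 2 / 2" and
          ?k1.0 = 0 and ?l1.0 = 1 and ?k2.0 = 1 and ?l2.0 = 0 and ?k3.0 = 0 and ?l3.0 = 0];
        (unfold half_angle_table cos_table that)?; use c golden_bounds in \<open>simp add: norm\<close>)
  show "dichotomy (pi) (2 * pi / 3) c" if "c\<^sup>2 = 2 / 3"
    by (rule dichotomy_sqrt2[where t = "sqrt 2" and
          ?k1.0 = 0 and ?l1.0 = 0 and ?k2.0 = 1 and ?l2.0 = 0 and ?k3.0 = 0 and ?l3.0 = "- 1"];
        (unfold half_angle_table cos_table that)?; use c golden_bounds in \<open>simp add: norm\<close>)
  show "dichotomy (2 * pi / 5) (2 * pi / 5) c" if "c\<^sup>2 = 1 / 5"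
    by (rule dichotomy_golden[where t = "(golden - 1) / 2" and
          ?k1.0 = 0 and ?l1.0 = 1 and ?k2.0 = 0 and ?l2.0 = 1 and ?k3.0 = 1 and ?l3.0 = 0];
        (unfold half_angle_table cos_table that)?; use c golden_bounds in \<open>simp add: norm\<close>)
  show "dichotomy (2 * pi / 5) (4 * pi / 5) c" if "c\<^sup>2 = 1 / 5"
    by (rule dichotomy_golden[where t = "1 / 2" and
          ?k1.0 = 0 and ?l1.0 = 1 and ?k2.0 = "- 1" and ?l2.0 = 1 and ?k3.0 = 0 and ?l3.0 = 0];
        (unfold half_angle_table cos_table that)?; use c golden_bounds in \<open>simp add: norm\<close>)
  show "dichotomy (4 * pi / 5) (4 * pi / 5) c" if "c\<^sup>2 = 1 / 5"
    by (rule dichotomy_golden[where t = "golden / 2" and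
          ?k1.0 = "- 1" and ?l1.0 = 1 and ?k2.0 = "- 1" and ?l2.0 = 1 and ?k3.0 = 1 and ?l3.0 = "- 1"];
        (unfold half_angle_table cos_table that)?; use c golden_bounds in \<open>simp add: norm\<close>)
  show "dichotomy (pi) (2 * pi / 3) c" if "c\<^sup>2 = (golden + 1) / 3"
    by (rule dichotomy_golden[where t = "golden" and
          ?k1.0 = 0 and ?l1.0 = 0 and ?k2.0 = 1 and ?l2.0 = 0 and ?k3.0 = 0 and ?l3.0 = "- 1"];
        (unfold half_angle_table cos_table that)?; use c golden_bounds in \<open>simp add: norm\<close>)
  show "dichotomy (pi) (2 * pi / 5) c" if "c\<^sup>2 = (golden + 2) / 5"
    by (rule dichotomy_golden[where t = "1" and
          ?k1.0 = 0 and ?l1.0 = 0 and ?k2.0 = 0 and ?l2.0 = 1 and ?k3.0 = "- 1" and ?l3.0 = 0];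
        (unfold half_angle_table cos_table that)?; use c golden_bounds in \<open>simp add: norm\<close>)
  show "dichotomy (pi) (2 * pi / 5) c" if "c\<^sup>2 = (3 - golden) / 5"
    by (rule dichotomy_golden[where t = "golden - 1" and
          ?k1.0 = 0 and ?l1.0 = 0 and ?k2.0 = 0 and ?l2.0 = 1 and ?k3.0 = 1 and ?l3.0 = "- 1"];
        (unfold half_angle_table cos_table that)?; use c golden_bounds in \<open>simp add: norm\<close>)
  show "dichotomy (pi) (4 * pi / 5) c" if "c\<^sup>2 = (golden + 2) / 5"
    by (rule dichotomy_golden[where t = "golden" and
          ?k1.0 = 0 and ?l1.0 = 0 and ?k2.0 = "- 1" and ?l2.0 = 1 and ?k3.0 = 0 and ?l3.0 = "- 1"];
        (unfold half_angle_table cos_table that)?; use c golden_bounds in \<open>simp add: norm\<close>)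
  show "dichotomy (pi) (4 * pi / 5) c" if "c\<^sup>2 = (3 - golden) / 5"
    by (rule dichotomy_golden[where t = "1" and
          ?k1.0 = 0 and ?l1.0 = 0 and ?k2.0 = "- 1" and ?l2.0 = 1 and ?k3.0 = "- 1" and ?l3.0 = 0];
        (unfold half_angle_table cos_table that)?; use c golden_bounds in \<open>simp add: norm\<close>)
  show "dichotomy (2 * pi / 3) (2 * pi / 3) c" if "c\<^sup>2 = 5 / 9"
    by (rule dichotomy_golden[where t = "golden - 1 / 2" and
          ?k1.0 = 1 and ?l1.0 = 0 and ?k2.0 = 1 and ?l2.0 = 0 and ?k3.0 = 1 and ?l3.0 = "- 1"];
        (unfold half_angle_table cos_table that)?; use c golden_bounds in \<open>simp add: norm\<close>)
  show "dichotomy (2 * pi / 3) (2 * pi / 5) c" if "c\<^sup>2 = (4 * golden + 3) / 15"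
    by (rule dichotomy_golden[where t = "golden / 2" and
          ?k1.0 = 1 and ?l1.0 = 0 and ?k2.0 = 0 and ?l2.0 = 1 and ?k3.0 = 0 and ?l3.0 = 0];
        (unfold half_angle_table cos_table that)?; use c golden_bounds in \<open>simp add: norm\<close>)
  show "dichotomy (2 * pi / 3) (2 * pi / 5) c" if "c\<^sup>2 = (7 - 4 * golden) / 15"
    by (rule dichotomy_golden[where t = "1 - golden / 2" and
          ?k1.0 = 1 and ?l1.0 = 0 and ?k2.0 = 0 and ?l2.0 = 1 and ?k3.0 = "- 1" and ?l3.0 = 1];
        (unfold half_angle_table cos_table that)?; use c golden_bounds in \<open>simp add: norm\<close>)
  show "dichotomy (2 * pi / 3) (4 * pi / 5) c" if "c\<^sup>2 = (4 * golden + 3) / 15"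
    by (rule dichotomy_golden[where t = "(golden + 1) / 2" and
          ?k1.0 = 1 and ?l1.0 = 0 and ?k2.0 = "- 1" and ?l2.0 = 1 and ?k3.0 = "- 1" and ?l3.0 = 0];
        (unfold half_angle_table cos_table that)?; use c golden_bounds in \<open>simp add: norm\<close>)
  show "dichotomy (2 * pi / 3) (4 * pi / 5) c" if "c\<^sup>2 = (7 - 4 * golden) / 15"
    by (rule dichotomy_golden[where t = "(golden - 1) / 2" and
          ?k1.0 = 1 and ?l1.0 = 0 and ?k2.0 = "- 1" and ?l2.0 = 1 and ?k3.0 = 0 and ?l3.0 = 0];
        (unfold half_angle_table cos_table that)?; use c golden_bounds in \<open>simp add: norm\<close>)
qed


section \<open>The listed triplets and their halvings\<close>

definition halves :: "real set \<Rightarrow> real set" where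
  "halves L = (\<lambda>\<theta>. \<theta> / 2) ` L"

text \<open>The bound \<open>\<pi>\<close> on both angles restricts only the angle that is not halved, as a listed angle is
  smaller than \<open>2\<pi>\<close>.\<close>

definition small :: "real set \<Rightarrow> real set" where
  "small L = {\<theta> \<in> L. \<theta> \<le> pi}"

lemma small_insert: "small (insert \<theta> L) = (if \<theta> \<le> pi then insert \<theta> (small L) else small L)"
  by (auto simp: small_def)

lemma small_empty: "small {} = {}"
  by (simp add: small_def)

lemma halves_table:
  "halves {pi} = {pi / 2}" "halves thirds = {pi / 3, 2 * pi / 3}"
  "halves quarters = {pi / 4, 3 * pi / 4}"
  "halves fifths = {pi / 5, 2 * pi / 5, 3 * pi / 5, 4 * pi / 5}"
  by (auto simp: halves_def thirds_def quarters_def fifths_def)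

lemma small_table:
  "small {pi} = {pi}" "small thirds = {2 * pi / 3}" "small quarters = {pi / 2}"
  "small fifths = {2 * pi / 5, 4 * pi / 5}"
  by (simp_all add: thirds_def quarters_def fifths_def small_insert small_empty)

definition halving_dichotomy :: "real set \<Rightarrow> real set \<Rightarrow> real \<Rightarrow> bool" where
  "halving_dichotomy L M c \<longleftrightarrow>
     (\<forall>a\<in>halves L. \<forall>b\<in>small M. dichotomy a b c) \<and> (\<forall>a\<in>small L. \<forall>b\<in>halves M. dichotomy a b c)"

lemma halving_dichotomyD:
  assumes "halving_dichotomy L M c" "\<theta> \<in> L" "\<eta> \<in> M"
    and "a = \<theta> / 2 \<and> b = \<eta> \<or> a = \<theta> \<and> b = \<eta> / 2" "a \<le> pi" "b \<le> pi"
  shows "dichotomy a b c"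
  using assms unfolding halving_dichotomy_def halves_def small_def by blast

lemmas dichotomy_rows = nonintegral_rows spherical_rows
  nonintegral_rows[THEN dichotomy_commute] spherical_rows[THEN dichotomy_commute]

lemma halving_dichotomy_table:
  "c\<^sup>2 = 1 / 3 \<Longrightarrow> 0 \<le> c \<Longrightarrow> halving_dichotomy {pi} thirds c"
  "c\<^sup>2 = 1 / 9 \<Longrightarrow> 0 \<le> c \<Longrightarrow> halving_dichotomy thirds thirds c"
  "c\<^sup>2 = 2 / 3 \<Longrightarrow> 0 \<le> c \<Longrightarrow> halving_dichotomy {pi} thirds c"
  "c\<^sup>2 = 1 / 2 \<Longrightarrow> 0 \<le> c \<Longrightarrow> halving_dichotomy {pi} quarters c"
  "c\<^sup>2 = 1 / 3 \<Longrightarrow> 0 \<le> c \<Longrightarrow> halving_dichotomy thirds quarters c"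
  "c\<^sup>2 = 0 \<Longrightarrow> 0 \<le> c \<Longrightarrow> halving_dichotomy quarters quarters c"
  "c\<^sup>2 = (golden + 1) / 3 \<Longrightarrow> 0 \<le> c \<Longrightarrow> halving_dichotomy {pi} thirds c"
  "c\<^sup>2 = (golden + 2) / 5 \<Longrightarrow> 0 \<le> c \<Longrightarrow> halving_dichotomy {pi} fifths c"
  "c\<^sup>2 = (3 - golden) / 5 \<Longrightarrow> 0 \<le> c \<Longrightarrow> halving_dichotomy {pi} fifths c"
  "c\<^sup>2 = 5 / 9 \<Longrightarrow> 0 \<le> c \<Longrightarrow> halving_dichotomy thirds thirds c"
  "c\<^sup>2 = (4 * golden + 3) / 15 \<Longrightarrow> 0 \<le> c \<Longrightarrow> halving_dichotomy thirds fifths c"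
  "c\<^sup>2 = (7 - 4 * golden) / 15 \<Longrightarrow> 0 \<le> c \<Longrightarrow> halving_dichotomy thirds fifths c"
  "c\<^sup>2 = 1 / 5 \<Longrightarrow> 0 \<le> c \<Longrightarrow> halving_dichotomy fifths fifths c"
  unfolding halving_dichotomy_def halves_table small_table ball_simps
  by (intro conjI TrueI; rule dichotomy_rows; assumption)+

lemma cos_squared_table:
  "(golden / sqrt 3)\<^sup>2 = (golden + 1) / 3"
  "(sqrt (golden / sqrt 5))\<^sup>2 = (golden + 2) / 5"
  "(sqrt (inverse golden / sqrt 5))\<^sup>2 = (3 - golden) / 5"
  "(sqrt (golden ^ 3 / (3 * sqrt 5)))\<^sup>2 = (4 * golden + 3) / 15"
  "(sqrt (inverse golden ^ 3 / (3 * sqrt 5)))\<^sup>2 = (7 - 4 * golden) / 15"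
proof -
  show "(golden / sqrt 3)\<^sup>2 = (golden + 1) / 3"
    by (simp add: power_divide power2_eq_square golden_square)
  have s5: "t / sqrt 5 = t * ((2 * golden - 1) / 5)" "t / (3 * sqrt 5) = t * ((2 * golden - 1) / 5) / 3" for t
    unfolding inverse_sqrt5[symmetric] by simp_all
  have "golden / sqrt 5 = ((golden + 2) / 5)" unfolding s5 inverse_golden
    by (simp add: power3_eq_cube field_simps golden_square golden_mult)
  then show "(sqrt (golden / sqrt 5))\<^sup>2 = (golden + 2) / 5" using golden_bounds by simp
  have "inverse golden / sqrt 5 = ((3 - golden) / 5)" unfolding s5 inverse_golden
    by (simp add: power3_eq_cube field_simps golden_square golden_mult)
  then show "(sqrt (inverse golden / sqrt 5))\<^sup>2 = (3 - golden) / 5" using golden_bounds by simp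
  have "golden ^ 3 / (3 * sqrt 5) = ((4 * golden + 3) / 15)" unfolding s5 inverse_golden
    by (simp add: power3_eq_cube field_simps golden_square golden_mult)
  then show "(sqrt (golden ^ 3 / (3 * sqrt 5)))\<^sup>2 = (4 * golden + 3) / 15" using golden_bounds by simp
  have "inverse golden ^ 3 / (3 * sqrt 5) = ((7 - 4 * golden) / 15)" unfolding s5 inverse_golden
    by (simp add: power3_eq_cube field_simps golden_square golden_mult)
  then show "(sqrt (inverse golden ^ 3 / (3 * sqrt 5)))\<^sup>2 = (7 - 4 * golden) / 15" using golden_bounds by simp
qed

lemma swap_closure_mono: "S \<subseteq> T \<Longrightarrow> swap_closure S \<subseteq> swap_closure T"
  by (auto simp: swap_closure_def)

text \<open>The three types together, with the angle of the axes given by its squared cosine. This makes the square roots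
  disappear; nothing is lost because \<open>cos \<phi> \<ge> 0\<close>.\<close>

definition squared_triplets :: "(real \<times> real \<times> real) set" where
  "squared_triplets = {(\<theta>1, \<theta>2, \<phi>). 0 < \<phi> \<and> \<phi> \<le> pi / 2 \<and>
     (\<theta>1 = pi \<and> \<theta>2 \<in> thirds \<and> (cos \<phi>)\<^sup>2 \<in> {1 / 3, 2 / 3, (golden + 1) / 3} \<or>
      \<theta>1 \<in> thirds \<and> \<theta>2 \<in> thirds \<and> (cos \<phi>)\<^sup>2 \<in> {1 / 9, 5 / 9} \<or>
      \<theta>1 = pi \<and> \<theta>2 \<in> quarters \<and> (cos \<phi>)\<^sup>2 = 1 / 2 \<or>
      \<theta>1 \<in> thirds \<and> \<theta>2 \<in> quarters \<and> (cos \<phi>)\<^sup>2 = 1 / 3 \<or>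
      \<theta>1 \<in> quarters \<and> \<theta>2 \<in> quarters \<and> (cos \<phi>)\<^sup>2 = 0 \<or>
      \<theta>1 = pi \<and> \<theta>2 \<in> fifths \<and> (cos \<phi>)\<^sup>2 \<in> {(golden + 2) / 5, (3 - golden) / 5} \<or>
      \<theta>1 \<in> thirds \<and> \<theta>2 \<in> fifths \<and> (cos \<phi>)\<^sup>2 \<in> {(4 * golden + 3) / 15, (7 - 4 * golden) / 15} \<or>
      \<theta>1 \<in> fifths \<and> \<theta>2 \<in> fifths \<and> (cos \<phi>)\<^sup>2 = 1 / 5)}"

lemma types_subset_squared_triplets: "type_A4 \<union> type_S4 \<union> type_A5 \<subseteq> swap_closure squared_triplets"
proof -
  have sq: "cos \<phi> = sqrt (1 / 3) \<Longrightarrow> (cos \<phi>)\<^sup>2 = 1 / 3" "cos \<phi> = 1 / 3 \<Longrightarrow> (cos \<phi>)\<^sup>2 = 1 / 9"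
    "cos \<phi> = sqrt (2 / 3) \<Longrightarrow> (cos \<phi>)\<^sup>2 = 2 / 3" "\<phi> = pi / 4 \<Longrightarrow> (cos \<phi>)\<^sup>2 = 1 / 2"
    "\<phi> = pi / 2 \<Longrightarrow> (cos \<phi>)\<^sup>2 = 0" "cos \<phi> = golden / sqrt 3 \<Longrightarrow> (cos \<phi>)\<^sup>2 = (golden + 1) / 3"
    "cos \<phi> = sqrt 5 / 3 \<Longrightarrow> (cos \<phi>)\<^sup>2 = 5 / 9" "cos \<phi> = 1 / sqrt 5 \<Longrightarrow> (cos \<phi>)\<^sup>2 = 1 / 5"
    "cos \<phi> \<in> {sqrt (golden / sqrt 5), sqrt (inverse golden / sqrt 5)} \<Longrightarrow>
       (cos \<phi>)\<^sup>2 \<in> {(golden + 2) / 5, (3 - golden) / 5}"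
    "cos \<phi> \<in> {sqrt (golden ^ 3 / (3 * sqrt 5)), sqrt (inverse golden ^ 3 / (3 * sqrt 5))} \<Longrightarrow>
       (cos \<phi>)\<^sup>2 \<in> {(4 * golden + 3) / 15, (7 - 4 * golden) / 15}" for \<phi> :: real
    using cos_squared_table by (auto simp only: cos_45 cos_pi_half power_divide) auto
  have "type_A4 \<subseteq> swap_closure squared_triplets" unfolding type_A4_def squared_triplets_def
    by (rule swap_closure_mono, rule subsetI) (clarify, elim disjE conjE; drule sq; blast)
  moreover have "type_S4 \<subseteq> swap_closure squared_triplets" unfolding type_S4_def squared_triplets_def
    by (rule swap_closure_mono, rule subsetI) (clarify, elim disjE conjE; drule sq; blast)
  moreover have "type_A5 \<subseteq> swap_closure squared_triplets" unfolding type_A5_def squared_triplets_def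
    by (rule swap_closure_mono, rule subsetI) (clarify, elim disjE conjE; drule sq; blast)
  ultimately show ?thesis by blast
qed

definition listed_angles :: "real set" where
  "listed_angles = {pi} \<union> thirds \<union> quarters \<union> fifths"

lemma squared_tripletsE:
  assumes "(\<theta>1, \<theta>2, \<phi>) \<in> squared_triplets"
  obtains L M where "0 < \<phi>" "\<phi> \<le> pi / 2" "\<theta>1 \<in> listed_angles" "\<theta>2 \<in> listed_angles"
    "halving_dichotomy L M (cos \<phi>)" "\<theta>1 \<in> L" "\<theta>2 \<in> M"
proof -
  note def = assms[unfolded squared_triplets_def mem_Collect_eq case_prod_conv]
  note \<phi> = def[THEN conjunct1] def[THEN conjunct2, THEN conjunct1]
    and cases = def[THEN conjunct2, THEN conjunct2]
  have "0 \<le> cos \<phi>" using \<phi> by (intro cos_ge_zero) auto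
  note rows = halving_dichotomy_table[OF _ this]
  have "\<theta>1 \<in> listed_angles" "\<theta>2 \<in> listed_angles"
    using cases unfolding listed_angles_def by (elim disjE conjE; blast)+
  moreover have "\<exists>L M. halving_dichotomy L M (cos \<phi>) \<and> \<theta>1 \<in> L \<and> \<theta>2 \<in> M"
    using cases by (elim disjE conjE insertE emptyE) ((rule exI)+, rule conjI, rule rows, assumption, blast)+
  ultimately show ?thesis using \<phi> by (elim exE conjE) (rule that)
qed

lemma listed_angle_bounds:
  assumes "\<theta> \<in> listed_angles"
  shows "\<theta> < 2 * pi"
  using assms pi_gt_zero unfolding listed_angles_def thirds_def quarters_def fifths_def
  by (elim UnE insertE emptyE) linarith+

lemma listed_angle_rational:
  assumes "\<theta> \<in> listed_angles"
  shows "\<theta> / pi \<in> \<rat>"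
  using assms unfolding listed_angles_def thirds_def quarters_def fifths_def
  by (elim UnE insertE emptyE) (hypsubst, simp)+

lemma algebraic_int_2cos_rational:
  assumes "x / pi \<in> \<rat>"
  shows "algebraic_int (2 * cos x)"
proof -
  obtain k n where kn: "x / pi = real_of_int k / real_of_int n" "n > 0"
    using assms by (metis Rats_cases')
  have "real (nat n) * x = real_of_int k * pi"
    using kn by (simp add: field_simps)
  then have "cos (real (nat n) * x) = 1 \<or> cos (real (nat n) * x) = -1"
    using cos_npi_int[of k] by (auto simp: mult.commute)
  then show ?thesis using kn(2) by (intro algebraic_int_2cos[of "nat n"]) simp_all
qed

lemma finite_generate_of_dichotomy:
  assumes "dichotomy a b (cos \<phi>)" "algebraic_int ((1 - cos a) * (1 - cos b) * (1 - (cos \<phi>)\<^sup>2))"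
    and "sin (a / 2) \<noteq> 0" "sin (b / 2) \<noteq> 0" "sin \<phi> \<noteq> 0"
  shows "finite (generate SO3 {rot (xquat (a / 2)), rot (xyquat \<phi> (b / 2))})"
proof -
  obtain \<gamma> \<gamma>' u v x' y' z' where
    \<gamma>: "\<gamma>\<^sup>2 = of_int u * \<gamma> + of_int v" "\<gamma>'\<^sup>2 = of_int u * \<gamma>' + of_int v" "\<gamma> \<noteq> \<gamma>'"
    and tr: "(2 * cos (a / 2), x') \<in> quadratic_pairs \<gamma> \<gamma>'" "(2 * cos (b / 2), y') \<in> quadratic_pairs \<gamma> \<gamma>'"
      "(2 * (cos (a / 2) * cos (b / 2) - sin (a / 2) * sin (b / 2) * cos \<phi>), z') \<in> quadratic_pairs \<gamma> \<gamma>'"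
    and s: "spherical x' y' z'"
    using assms(1,2) unfolding dichotomy_def by blast
  show ?thesis
    by (rule finite_generate_of_spherical_conjugate[OF \<gamma> _ _ _ _ _ _ _ _ _ _ s])
      (use assms tr in \<open>simp_all add: qnorm2_xquat qnorm2_xyquat, simp_all add: xquat_def xyquat_def mult.assoc\<close>)
qed

theorem proposition6p2:
  fixes \<epsilon> \<theta>1 \<theta>2 \<phi> \<theta>1' \<theta>2' :: real
    and C1' C2' C1 C2 :: "real^3^3"
    and E :: "torus \<Rightarrow> 'v::real_vector set"
    and A :: "(4, 'v) atlas"
    and h :: "torus \<Rightarrow> 'v \<Rightarrow> 'v \<Rightarrow> real"
    and D :: "'v conn"
    and D2 :: "'v bivector conn"
    and \<omega> :: "3 \<Rightarrow> 'v bivector"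
  assumes "\<epsilon> \<in> {1, -1}"
    and "(\<exists>n::nat. prime n \<and> n > 2 \<and> (\<theta>1, \<theta>2, \<phi>) = (pi, 2 * pi / real n, pi / 2)) \<or>
         (\<theta>1, \<theta>2, \<phi>) \<in> type_A4 \<union> type_S4 \<union> type_A5"
    and "(\<theta>1', \<theta>2') = (\<theta>1 / 2, \<theta>2) \<or> (\<theta>1', \<theta>2') = (\<theta>1, \<theta>2 / 2)"
    and "0 < \<theta>1'" and "\<theta>1' \<le> pi" and "0 < \<theta>2'" and "\<theta>2' \<le> pi"
    and "C1' = Cmat \<theta>1'"
    and "C2' = Umat \<phi> ** Cmat \<theta>2' ** transpose (Umat \<phi>)"
    and "oriented_bundle E A"
    and "bundle_metric E A h"
    and "h_connection A h D"
    and "induced_connection A D D2"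
    and "pos_orthonormal_dual_basis \<epsilon> A h (pr (0, 0)) \<omega>"
    and "holonomy_matrix \<epsilon> A h D2 \<omega> (1, 0) C1"
    and "holonomy_matrix \<epsilon> A h D2 \<omega> (0, 1) C2"
    and "C1 = C1'" and "C2 = C2'"
    and "infinite (generate SO3 {C1, C2})"
  shows "(C1' ** C2') ** (C2' ** C1') \<noteq> (C2' ** C1') ** (C1' ** C2') \<and>
         infinite_order SO3 (C1' ** C2') \<and> infinite_order SO3 (C2' ** C1')"
proof -
  define p q where "p = xquat (\<theta>1' / 2)" and "q = xyquat \<phi> (\<theta>2' / 2)"
  have C: "C1' = rot p" "C2' = rot q"
    unfolding assms(8,9) p_def q_def by (rule Cmat_eq_rot, rule conjugate_Cmat_eq_rot)
  have inf: "infinite (generate SO3 {rot p, rot q})" using assms(17-19) C by simp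
  have s1: "sin (\<theta>1' / 2) > 0" "sin (\<theta>2' / 2) > 0"
    using assms(4-7) by (auto intro!: sin_gt_zero)
  have "sin \<phi> > 0 \<and> \<theta>1 / pi \<in> \<rat> \<and> \<theta>2 / pi \<in> \<rat> \<and> \<theta>1 < 2 * pi \<and> \<theta>2 < 2 * pi \<and>
     \<not> algebraic_int ((1 - cos \<theta>1') * (1 - cos \<theta>2') * (1 - (cos \<phi>)\<^sup>2))"
    using assms(2)
  proof
    assume "\<exists>n::nat. prime n \<and> n > 2 \<and> (\<theta>1, \<theta>2, \<phi>) = (pi, 2 * pi / real n, pi / 2)"
    then obtain n :: nat where n: "prime n" "n > 2" and \<theta>: "\<theta>1 = pi" "\<theta>2 = 2 * pi / real n" "\<phi> = pi / 2"
      by auto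
    \<comment> \<open>Halving the other angle gives a half turn and a rotation by \<open>\<pi>/n\<close> about orthogonal axes.\<close>
    have "(\<theta>1', \<theta>2') = (\<theta>1 / 2, \<theta>2)"
    proof (rule ccontr)
      assume "(\<theta>1', \<theta>2') \<noteq> (\<theta>1 / 2, \<theta>2)"
      then have "\<theta>1' = pi" "\<theta>2' = pi / real n" using assms(3) \<theta> by auto
      then have "finite (generate SO3 {rot p, rot q})"
        using finite_generate_dihedral[of n] n by (simp add: p_def q_def \<theta> mult.commute)
      then show False using inf by blast
    qed
    then have \<theta>': "\<theta>1' = pi / 2" "\<theta>2' = 2 * pi / real n" using \<theta> by simp_all
    have "(1 - cos \<theta>1') * (1 - cos \<theta>2') * (1 - (cos \<phi>)\<^sup>2) = 1 - cos (2 * pi / real n)"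
      unfolding \<theta>' \<theta>(3) by simp
    moreover have "\<not> algebraic_int (1 - cos (2 * pi / real n))"
    proof
      assume "algebraic_int (1 - cos (2 * pi / real n))"
      from algebraic_int_diff_real[OF algebraic_int_1 this] have "algebraic_int (cos (2 * pi / real n))" by simp
      then show False using not_algebraic_int_cos_odd[of n] prime_odd_nat[OF n] n by simp
    qed
    moreover have "2 * pi / real n < 2 * pi" using n(2) by (simp add: field_simps)
    ultimately show ?thesis using n by (simp add: \<theta>)
  next
    assume t: "(\<theta>1, \<theta>2, \<phi>) \<in> type_A4 \<union> type_S4 \<union> type_A5"
    obtain L M where \<phi>: "0 < \<phi>" "\<phi> \<le> pi / 2"
      and l: "\<theta>1 \<in> listed_angles" "\<theta>2 \<in> listed_angles" and LM: "halving_dichotomy L M (cos \<phi>)"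
      "\<theta>1 \<in> L \<and> \<theta>2 \<in> M \<or> \<theta>2 \<in> L \<and> \<theta>1 \<in> M"
    proof -
      have "(\<theta>1, \<theta>2, \<phi>) \<in> squared_triplets \<or> (\<theta>2, \<theta>1, \<phi>) \<in> squared_triplets"
        using t types_subset_squared_triplets unfolding swap_closure_def by blast
      then show ?thesis by (elim disjE squared_tripletsE) (rule that, assumption+, blast)+
    qed
    have s\<phi>: "sin \<phi> > 0" using \<phi> pi_gt_zero by (intro sin_gt_zero) auto
    have "dichotomy \<theta>1' \<theta>2' (cos \<phi>)"
      using LM(2)
    proof
      assume "\<theta>1 \<in> L \<and> \<theta>2 \<in> M"
      then show ?thesis
        using assms(3,5,7) by (intro halving_dichotomyD[OF LM(1), of \<theta>1 \<theta>2]) auto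
    next
      assume "\<theta>2 \<in> L \<and> \<theta>1 \<in> M"
      then show ?thesis
        using assms(3,5,7)
        by (intro dichotomy_commute[OF halving_dichotomyD[OF LM(1), of \<theta>2 \<theta>1]]) auto
    qed
    then have "algebraic_int ((1 - cos \<theta>1') * (1 - cos \<theta>2') * (1 - (cos \<phi>)\<^sup>2)) \<Longrightarrow>
        finite (generate SO3 {rot p, rot q})"
      unfolding p_def q_def using s1 s\<phi> by (intro finite_generate_of_dichotomy) simp_all
    then have "\<not> algebraic_int ((1 - cos \<theta>1') * (1 - cos \<theta>2') * (1 - (cos \<phi>)\<^sup>2))"
      using inf by blast
    then show ?thesis using s\<phi> l listed_angle_bounds listed_angle_rational by blast
  qed
  then have s\<phi>: "sin \<phi> > 0" and rat: "\<theta>1 / pi \<in> \<rat>" "\<theta>2 / pi \<in> \<rat>" and lt: "\<theta>1 < 2 * pi" "\<theta>2 < 2 * pi"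
    and nonint: "\<not> algebraic_int ((1 - cos \<theta>1') * (1 - cos \<theta>2') * (1 - (cos \<phi>)\<^sup>2))" by blast+
  have half: "x / 2 / pi \<in> \<rat>" if "x / pi \<in> \<rat>" for x
    using Rats_divide[OF that Rats_number_of, of "num.Bit0 num.One"] by (simp add: mult.commute)
  have "\<theta>1' = \<theta>1 \<or> \<theta>1' = \<theta>1 / 2" "\<theta>2' = \<theta>2 \<or> \<theta>2' = \<theta>2 / 2"
    using assms(3) by auto
  then have "\<theta>1' / pi \<in> \<rat>" "\<theta>2' / pi \<in> \<rat>"
    using rat half by blast+
  note rat' = this[THEN half]
  have pq: "infinite_order SO3 (rot (p * q))"
    using gram_integral_of_finite_order[OF rat'[THEN algebraic_int_2cos_rational]] nonint
    unfolding p_def q_def by blast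
  have "cos (\<theta>1' / 2) \<noteq> 0 \<or> cos (\<theta>2' / 2) \<noteq> 0"
  proof -
    have "cos (x / 2) \<noteq> 0" if "0 < x" "x < pi" for x
      using cos_gt_zero[of "x / 2"] that by simp
    moreover have "\<theta>1' < pi \<or> \<theta>2' < pi" using assms(3) lt by auto
    ultimately show ?thesis using assms(4,6) by blast
  qed
  then have "rot ((p * q) * (q * p)) \<noteq> rot ((q * p) * (p * q))"
    using infinite_order_products_do_not_commute[OF s\<phi> s1] pq unfolding p_def q_def by blast
  moreover have "infinite_order SO3 (rot (q * p))"
    using infinite_order_swap[OF _ pq] by (simp add: p_def qnorm2_xquat)
  ultimately show ?thesis using pq by (simp add: C rot_mult)
qed

end
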